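(* Fix $L>0$. There exists $C>0$ such that the following holds. Let $f\in\mathcal C^3([0,L])$ and $\beta,\gamma\in\mathbb R$ with $\gamma-\beta+\int_0^Lf=0$. Let $\tilde u^0\in H^6(0,L)$ satisfy $\partial_x\tilde u^0(0)=\beta$, $\partial_x\tilde u^0(L)=\gamma$, $\partial_x^3\tilde u^0(0)=-\partial_xf(0)$, $\partial_x^3\tilde u^0(L)=-\partial_xf(L)$, $\partial_x^5\tilde u^0(0)=-\partial_x^3f(0)$, $\partial_x^5\tilde u^0(L)=-\partial_x^3f(L)$, and let $\tilde u$ be the solution of $\partial_t\tilde u-\partial_x^2\tilde u=f$ on $(0,L)$, $\tilde u(0,\cdot)=\tilde u^0$, $\partial_x\tilde u(t,0)=\beta$, $\partial_x\tilde u(t,L)=\gamma$. Let $J\ge2$ and $\delta t\in(0,1)$ with $\delta t/\delta x^2\le1/2$, let $\tilde{\mathsf v}^0\in\mathbb R^J$ be arbitrary, and define $\tilde{\mathsf v}^{n+1}=(\mathrm{Id}+\delta t\,\mathsf P_\delta)\tilde{\mathsf v}^n+\delta t\,\mathsf b_{\delta x}$ with $\mathsf b_{\delta x}=\Pi_{\delta x}f+\frac1{\delta x}(-\beta,0,\dots,0,\gamma)^\top+r_{\delta x}\mathbb 1$ and $r_{\delta x}=\frac1{J\delta x}\big(\int_0^Lf(x)dx-\delta x\sum_{j=0}^{J-1}f(x_j)\big)$. Then for all $n\in\mathbb N$, $$\|\Pi_{\delta x}\tilde u(n\delta t)-\tilde{\mathsf v}^n\|_{\ell^2}\le\|\Pi_{\delta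 x}\tilde u^0-\tilde{\mathsf v}^0\|_{\ell^2}+C(\delta x+\delta t)\big(\|\tilde u^0\|_{H^5}+\|f\|_{H^3}\big).$$
   Context: For $J\ge2$: $\delta x=L/(J-1)$, $x_j=j\delta x$ ($0\le j\le J-1$), $\mathbb 1=(1,\dots,1)^\top\in\mathbb R^J$, $\|\mathsf v\|_{\ell^2}^2=\frac1J\sum_j\mathsf v_j^2$, $\Pi_{\delta x}w=(w(x_j))_{0\le j\le J-1}$, and $\mathsf P_\delta=\frac1{\delta x^2}\times$ the tridiagonal $J\times J$ matrix with diagonal $(-1,-2,\dots,-2,-1)$ and off-diagonals $1$. $H^s$ norms are the standard Sobolev norms on $(0,L)$. *)

theory Defs
  imports "HOL-Analysis.Analysis"
begin

text \<open>Sobolev space H^k(0,L) in one dimension, via the (continuous representatives of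
  the) successive weak derivatives: D 0 = u on [0,L], each D i (i<k) is absolutely
  continuous with a.e.-derivative D (i+1), and all D i (i \<le> k) are square integrable.\<close>
definition Hk_derivs :: "real \<Rightarrow> nat \<Rightarrow> (real \<Rightarrow> real) \<Rightarrow> (nat \<Rightarrow> real \<Rightarrow> real) \<Rightarrow> bool" where
  "Hk_derivs L k u D \<longleftrightarrow>
     (\<forall>x\<in>{0..L}. D 0 x = u x) \<and>
     (\<forall>i\<le>k. D i absolutely_integrable_on {0..L} \<and> (\<lambda>x. (D i x)^2) integrable_on {0..L}) \<and>
     (\<forall>i<k. \<forall>x\<in>{0..L}. D i x = D i 0 + integral {0..x} (D (Suc i)))"

definition in_H :: "real \<Rightarrow> nat \<Rightarrow> (real \<Rightarrow> real) \<Rightarrow> bool" where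
  "in_H L k u \<longleftrightarrow> (\<exists>D. Hk_derivs L k u D)"

definition H_norm :: "real \<Rightarrow> nat \<Rightarrow> (real \<Rightarrow> real) \<Rightarrow> real" where
  "H_norm L k u = (let D = (SOME D. Hk_derivs L k u D) in
     sqrt (\<Sum>i\<le>k. integral {0..L} (\<lambda>x. (D i x)^2)))"

definition Ck_derivs :: "real \<Rightarrow> nat \<Rightarrow> (real \<Rightarrow> real) \<Rightarrow> (nat \<Rightarrow> real \<Rightarrow> real) \<Rightarrow> bool" where
  "Ck_derivs L k f F \<longleftrightarrow>
     (\<forall>x\<in>{0..L}. F 0 x = f x) \<and>
     (\<forall>i\<le>k. continuous_on {0..L} (F i)) \<and>
     (\<forall>i<k. \<forall>x\<in>{0..L}. (F i has_real_derivative F (Suc i) x) (at x within {0..L}))"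

definition heat_neumann_solution ::
  "real \<Rightarrow> (real \<Rightarrow> real) \<Rightarrow> real \<Rightarrow> real \<Rightarrow> (real \<Rightarrow> real) \<Rightarrow> (real \<Rightarrow> real \<Rightarrow> real) \<Rightarrow> bool" where
  "heat_neumann_solution L f \<beta> \<gamma> u0 u \<longleftrightarrow>
     (\<exists>ux uxx ut :: real \<Rightarrow> real \<Rightarrow> real.
        continuous_on ({0..} \<times> {0..L}) (\<lambda>(t,x). u t x) \<and>
        continuous_on ({0<..} \<times> {0..L}) (\<lambda>(t,x). ux t x) \<and>
        continuous_on ({0<..} \<times> {0..L}) (\<lambda>(t,x). uxx t x) \<and>
        continuous_on ({0<..} \<times> {0..L}) (\<lambda>(t,x). ut t x) \<and>
        (\<forall>t>0. \<forall>x\<in>{0..L}.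
           ((\<lambda>y. u t y) has_real_derivative ux t x) (at x within {0..L}) \<and>
           ((\<lambda>y. ux t y) has_real_derivative uxx t x) (at x within {0..L}) \<and>
           ((\<lambda>s. u s x) has_real_derivative ut t x) (at t)) \<and>
        (\<forall>t>0. \<forall>x\<in>{0<..<L}. ut t x - uxx t x = f x) \<and>
        (\<forall>t>0. ux t 0 = \<beta> \<and> ux t L = \<gamma>) \<and>
        (\<forall>x\<in>{0..L}. u 0 x = u0 x))"

text \<open>Discrete setting: vectors of R^J as functions nat \<Rightarrow> real on indices j < J.\<close>
definition dx :: "real \<Rightarrow> nat \<Rightarrow> real" where
  "dx L J = L / (real J - 1)"

definition grid :: "real \<Rightarrow> nat \<Rightarrow> nat \<Rightarrow> real" where
  "grid L J j = real j * dx L J"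

definition l2norm :: "nat \<Rightarrow> (nat \<Rightarrow> real) \<Rightarrow> real" where
  "l2norm J v = sqrt ((1 / real J) * (\<Sum>j<J. (v j)^2))"

definition proj :: "real \<Rightarrow> nat \<Rightarrow> (real \<Rightarrow> real) \<Rightarrow> nat \<Rightarrow> real" where
  "proj L J w = (\<lambda>j. w (grid L J j))"

definition Pmat :: "nat \<Rightarrow> real \<Rightarrow> nat \<Rightarrow> nat \<Rightarrow> real" where
  "Pmat J h i k =
     (if i = k then (if i = 0 \<or> i = J - 1 then -1 else -2)
      else if i = k + 1 \<or> k = i + 1 then 1 else 0) / h^2"

definition r_dx :: "real \<Rightarrow> nat \<Rightarrow> (real \<Rightarrow> real) \<Rightarrow> real" where
  "r_dx L J f = (integral {0..L} f - dx L J * (\<Sum>j<J. f (grid L J j))) / (real J * dx L J)"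

definition b_dx :: "real \<Rightarrow> nat \<Rightarrow> (real \<Rightarrow> real) \<Rightarrow> real \<Rightarrow> real \<Rightarrow> nat \<Rightarrow> real" where
  "b_dx L J f \<beta> \<gamma> j = f (grid L J j)
      + (if j = 0 then - \<beta> / dx L J else 0)
      + (if j = J - 1 then \<gamma> / dx L J else 0)
      + r_dx L J f"

end

theory Submission
  imports Defs
begin

text \<open>
  Everything about the continuous problem follows from the maximum principle with Neumann boundary
  conditions. The compatibility conditions make \<open>u0 + t (u0'' + f)\<close> an approximate solution with
  right hand side \<open>t (u0'''' + f'')\<close>, so it is \<open>O(t\<^sup>2)\<close>-close to \<open>u\<close>; applied to the homogeneous
  problems solved by time differences of \<open>u\<close>, the maximum principle carries this over to all times
  and bounds the second differences of \<open>u\<close> in time, hence \<open>u\<^sub>t\<close>, its Lipschitz constants in \<open>t\<close> and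
  \<open>x\<close>, and the one of \<open>u\<^sub>x\<^sub>x = u\<^sub>t - f\<close>. No derivative beyond those of a classical solution is needed.

  The scheme is consistent of first order at interior nodes but only \<open>O(1)\<close> at the two boundary
  nodes. These contributions are the discrete Laplacian of an \<open>O(h)\<close> corrector, up to \<open>O(h)\<close> terms.
  On mean-zero vectors one step of the scheme contracts by \<open>1 - c \<delta>t\<close>, which gives a bound uniform in
  the number of steps; the means are controlled by conservation of mass.
\<close>

subsection \<open>The maximum principle and one-dimensional calculus\<close>

text \<open>The estimate must be uniform in n and keep the factor 1 in front of the initial error.
  This forces the mean and the deviation from it to be treated apart: defects of the deviation sum
  to a geometric series, whereas nothing damps the mean, where a defect would grow linearly in time.
  So no truncation error is ever summed for the mean. Exact conservation on both sides leaves a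
  single quadrature error at the time considered; the constant vector in \<open>b_dx\<close> is what
  makes the discrete conservation exact.

  The norms in the bound fix how much regularity may be spent: order 5 of \<open>u0\<close> and
  order 3 of \<open>f\<close> control, in the supremum, derivatives up to order 4 and 2. This is
  just enough for \<open>M\<close>, a bound on what u_tt would be at time 0. The derivatives of
  \<open>u\<close> are given for positive times only, so estimates are proved for increments of
  \<open>u\<close>, which make sense down to time 0, and are divided by the step afterwards.\<close>

lemma second_derivative_nonpos_at_max:
  fixes y y' :: "real \<Rightarrow> real"
  assumes "a < b" and x0: "x0 \<in> {a..b}"
    and y: "\<And>x. x \<in> {a..b} \<Longrightarrow> (y has_real_derivative y' x) (at x within {a..b})"
    and y': "(y' has_real_derivative d) (at x0 within {a..b})"
    and crit: "y' x0 = 0" and max: "\<And>x. x \<in> {a..b} \<Longrightarrow> y x \<le> y x0"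
  shows "d \<le> 0"
proof (rule ccontr)
  assume "\<not> d \<le> 0"
  then have d: "d > 0" by simp
  have mvt: "\<exists>z. p < z \<and> z < q \<and> y q - y p = (q - p) * y' z"
    if "p < q" "p \<in> {a..b}" "q \<in> {a..b}" for p q
  proof -
    have "\<exists>z\<in>{p<..<q}. y q - y p = (*) (y' z) (q - p)"
    proof (rule mvt_simple[OF \<open>p < q\<close>])
      fix x assume x: "p \<le> x" "x \<le> q"
      then have "(y has_real_derivative y' x) (at x within {p..q})"
        using that by (intro DERIV_subset[OF y]) auto
      then show "(y has_derivative (*) (y' x)) (at x within {p..q})"
        by (simp add: has_field_derivative_def)
    qed
    then show ?thesis by (auto simp: mult.commute)
  qed
  show False
  \<comment> \<open>A positive \<open>d\<close> makes \<open>y'\<close> cross zero upwards at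
    \<open>x0\<close>, so \<open>y\<close> rises strictly just to the right of \<open>x0\<close>; at
    the right end one looks to the left instead, where \<open>y\<close> falls towards
    \<open>x0\<close>. One side suffices, so boundary points are covered.\<close>
  proof (cases "x0 < b")
    case True
    obtain e where e: "e > 0" "\<And>h. h > 0 \<Longrightarrow> x0 + h \<in> {a..b} \<Longrightarrow> h < e \<Longrightarrow> y' x0 < y' (x0 + h)"
      using has_real_derivative_pos_inc_right[OF y' d] by auto
    define q where "q = x0 + min (e/2) (b - x0)"
    have q: "x0 < q" "q \<in> {a..b}" "q - x0 < e" using e(1) True x0 by (auto simp: q_def min_def)
    obtain z where z: "x0 < z" "z < q" "y q - y x0 = (q - x0) * y' z" using mvt[OF q(1) x0 q(2)] by auto
    have "y' z > 0" using e(2)[of "z - x0"] z q x0 crit by auto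
    then have "y q > y x0" using z(3) q(1) by (smt (verit) mult_pos_pos)
    then show False using max[OF q(2)] by simp
  next
    case False
    then have b: "x0 = b" using x0 by auto
    obtain e where e: "e > 0" "\<And>h. h > 0 \<Longrightarrow> x0 - h \<in> {a..b} \<Longrightarrow> h < e \<Longrightarrow> y' (x0 - h) < y' x0"
      using has_real_derivative_pos_inc_left[OF y' d] by auto
    define p where "p = x0 - min (e/2) (b - a)"
    have p: "p < x0" "p \<in> {a..b}" "x0 - p < e" using e(1) b \<open>a < b\<close> by (auto simp: p_def min_def)
    obtain z where z: "p < z" "z < x0" "y x0 - y p = (x0 - p) * y' z" using mvt[OF p(1) p(2) x0] by auto
    have "y' z < 0" using e(2)[of "x0 - z"] z p x0 crit by auto
    then have "y x0 < y p" using z(3) p(1) by (smt (verit) mult_pos_neg)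
    then show False using max[OF p(2)] by simp
  qed
qed

text \<open>\<open>B * t + A * t\<^sup>2 / 2\<close> is the antiderivative of the source bound;
  subtracting it and a further \<open>\<epsilon> * t\<close> makes the differential inequality
  strict, which excludes a maximum at positive time. At the two ends the zero slope makes a maximum
  a critical point, so the second derivative test applies there as well. The source
  \<open>A * t\<close> is the shape of the residual of a first order expansion around time
  0.\<close>

lemma neumann_maximum_principle:
  fixes w wx wxx wt :: "real \<Rightarrow> real \<Rightarrow> real"
  assumes "L > 0"
    and cont: "continuous_on ({0..} \<times> {0..L}) (\<lambda>(t, x). w t x)"
    and wx: "\<And>t x. t > 0 \<Longrightarrow> x \<in> {0..L} \<Longrightarrow> (w t has_real_derivative wx t x) (at x within {0..L})"
    and wxx: "\<And>t x. t > 0 \<Longrightarrow> x \<in> {0..L} \<Longrightarrow> (wx t has_real_derivative wxx t x) (at x within {0..L})"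
    and wt: "\<And>t x. t > 0 \<Longrightarrow> x \<in> {0..L} \<Longrightarrow> ((\<lambda>s. w s x) has_real_derivative wt t x) (at t)"
    and bc: "\<And>t. t > 0 \<Longrightarrow> wx t 0 = 0" "\<And>t. t > 0 \<Longrightarrow> wx t L = 0"
    and sub: "\<And>t x. t > 0 \<Longrightarrow> x \<in> {0..L} \<Longrightarrow> wt t x - wxx t x \<le> A * t + B"
    and init: "\<And>x. x \<in> {0..L} \<Longrightarrow> w 0 x \<le> m"
    and t: "t \<ge> 0" and x: "x \<in> {0..L}"
  shows "w t x \<le> m + B * t + A * t\<^sup>2 / 2"
proof -
  have key: "w t x \<le> m + B * t + A * t\<^sup>2 / 2 + \<epsilon> * t" if "\<epsilon> > 0" for \<epsilon>
  proof -
    define y where "y = (\<lambda>s z. w s z - (B * s + A * s\<^sup>2 / 2 + \<epsilon> * s))"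
    have "continuous_on ({0..t} \<times> {0..L}) (\<lambda>(s, z). w s z)"
      by (rule continuous_on_subset[OF cont]) auto
    then have "continuous_on ({0..t} \<times> {0..L}) (\<lambda>p. y (fst p) (snd p))"
      unfolding y_def by (auto intro!: continuous_intros simp: case_prod_unfold)
    moreover have "{0..t} \<times> {0..L} \<noteq> {}" using t x by auto
    ultimately obtain p where p: "p \<in> {0..t} \<times> {0..L}"
      and max: "\<And>q. q \<in> {0..t} \<times> {0..L} \<Longrightarrow> y (fst q) (snd q) \<le> y (fst p) (snd p)"
      using continuous_attains_sup[of "{0..t} \<times> {0..L}" "\<lambda>p. y (fst p) (snd p)"]
      by (auto simp: compact_Times)
    obtain s z where [simp]: "p = (s, z)" by force
    have sz: "s \<in> {0..t}" "z \<in> {0..L}" using p by auto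
    have "s = 0"
    proof (rule ccontr)
      assume "s \<noteq> 0"
      then have s: "s > 0" using sz by auto
      have dy: "(y s has_real_derivative wx s x') (at x' within {0..L})" if "x' \<in> {0..L}" for x'
        unfolding y_def by (auto intro!: derivative_eq_intros wx that s)
      have ymax: "y s x' \<le> y s z" if "x' \<in> {0..L}" for x'
        using max[of "(s, x')"] that sz by auto
      have crit: "wx s z = 0"
      proof (cases "0 < z \<and> z < L")
        case True
        have "(y s has_real_derivative wx s z) (at z)"
          using dy[OF sz(2)] True at_within_Icc_at[of 0 z L] by auto
        then show ?thesis
          by (rule DERIV_local_max[where d = "min z (L - z)"]) (use True ymax in \<open>auto simp: abs_if split: if_splits\<close>)
      next
        case False
        then have "z = 0 \<or> z = L" using sz by auto
        then show ?thesis using bc s by auto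
      qed
      have "wxx s z \<le> 0"
        by (rule second_derivative_nonpos_at_max[OF \<open>L > 0\<close> sz(2) dy wxx[OF s sz(2)] crit ymax])
      \<comment> \<open>The maximum may sit at the final time \<open>t\<close>, so the comparison is
        with earlier times.\<close>
      moreover have "wt s z - (B + A * s + \<epsilon>) \<ge> 0"
      proof (rule ccontr)
        assume "\<not> ?thesis"
        then have neg: "wt s z - (B + A * s + \<epsilon>) < 0" by simp
        have "((\<lambda>s. y s z) has_real_derivative (wt s z - (B + A * s + \<epsilon>))) (at s)"
          unfolding y_def by (auto intro!: derivative_eq_intros wt[OF s sz(2)])
        from DERIV_neg_dec_left[OF this neg] obtain e where e: "e > 0"
          "\<And>h. h > 0 \<Longrightarrow> h < e \<Longrightarrow> y s z < y (s - h) z" by auto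
        define h where "h = min (e/2) (s/2)"
        have "h > 0" "h < e" "s - h \<in> {0..t}" using e(1) s sz by (auto simp: h_def min_def)
        then have "y s z < y (s - h) z" "y (s - h) z \<le> y s z"
          using e(2) max[of "(s - h, z)"] sz by auto
        then show False by simp
      qed
      ultimately show False using sub[OF s sz(2)] \<open>\<epsilon> > 0\<close> by simp
    qed
    then have "y t x \<le> m"
      using max[of "(t, x)"] t x init[OF sz(2)] by (auto simp: y_def)
    then show ?thesis by (simp add: y_def)
  qed
  show ?thesis
  proof (rule field_le_epsilon)
    fix e :: real assume e: "e > 0"
    have "e / (t + 1) * t \<le> e" using t e by (simp add: field_simps)
    then show "w t x \<le> m + B * t + A * t\<^sup>2 / 2 + e"
      using key[of "e / (t + 1)"] e t by auto
  qed
qed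

lemma neumann_maximum_principle_abs:
  fixes w wx wxx wt :: "real \<Rightarrow> real \<Rightarrow> real"
  assumes "L > 0"
    and cont: "continuous_on ({0..} \<times> {0..L}) (\<lambda>(t, x). w t x)"
    and wx: "\<And>t x. t > 0 \<Longrightarrow> x \<in> {0..L} \<Longrightarrow> (w t has_real_derivative wx t x) (at x within {0..L})"
    and wxx: "\<And>t x. t > 0 \<Longrightarrow> x \<in> {0..L} \<Longrightarrow> (wx t has_real_derivative wxx t x) (at x within {0..L})"
    and wt: "\<And>t x. t > 0 \<Longrightarrow> x \<in> {0..L} \<Longrightarrow> ((\<lambda>s. w s x) has_real_derivative wt t x) (at t)"
    and bc: "\<And>t. t > 0 \<Longrightarrow> wx t 0 = 0" "\<And>t. t > 0 \<Longrightarrow> wx t L = 0"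
    and rhs: "\<And>t x. t > 0 \<Longrightarrow> x \<in> {0..L} \<Longrightarrow> \<bar>wt t x - wxx t x\<bar> \<le> A * t + B"
    and init: "\<And>x. x \<in> {0..L} \<Longrightarrow> \<bar>w 0 x\<bar> \<le> m"
    and t: "t \<ge> 0" and x: "x \<in> {0..L}"
  shows "\<bar>w t x\<bar> \<le> m + B * t + A * t\<^sup>2 / 2"
proof -
  have "w t x \<le> m + B * t + A * t\<^sup>2 / 2"
    by (rule neumann_maximum_principle[OF \<open>L > 0\<close> cont wx wxx wt bc _ _ t x])
      (use rhs init in \<open>fastforce simp: abs_le_iff\<close>)+
  moreover have "- w t x \<le> m + B * t + A * t\<^sup>2 / 2"
  proof (rule neumann_maximum_principle[where w = "\<lambda>t x. - w t x" and wx = "\<lambda>t x. - wx t x"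
        and wxx = "\<lambda>t x. - wxx t x" and wt = "\<lambda>t x. - wt t x", OF \<open>L > 0\<close> _ _ _ _ _ _ _ _ t x])
    show "continuous_on ({0..} \<times> {0..L}) (\<lambda>(t, x). - w t x)"
      using continuous_on_minus[OF cont] by (simp add: case_prod_unfold)
  next
    fix t x assume "t > (0::real)" "x \<in> {0..L}"
    then show "- wt t x - - wxx t x \<le> A * t + B" using rhs[of t x] by (auto simp: abs_le_iff)
  next
    fix x assume "x \<in> {0..L}"
    then show "- w 0 x \<le> m" using init[of x] by (auto simp: abs_le_iff)
  qed (auto intro!: DERIV_minus wx wxx wt simp: bc)
  ultimately show ?thesis by (simp add: abs_le_iff)
qed

section \<open>Difference quotients and Taylor remainders without the highest derivative\<close>

lemma DERIV_abs_bound: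
  fixes q :: "real \<Rightarrow> real"
  assumes "(q has_real_derivative d) (at t)"
    and "\<And>h. h > 0 \<Longrightarrow> \<bar>q (t + h) - q t\<bar> \<le> K * h + K' * h\<^sup>2"
  shows "\<bar>d\<bar> \<le> K"
proof (rule tendsto_le[of "at_right 0"])
  show "((\<lambda>h. K + K' * h) \<longlongrightarrow> K) (at_right 0)"
    by (auto intro!: tendsto_eq_intros)
  have "((\<lambda>h. (q (t + h) - q t) / h) \<longlongrightarrow> d) (at_right 0)"
    using assms(1) unfolding DERIV_def by (rule filterlim_mono) (auto simp: at_le)
  then show "((\<lambda>h. \<bar>(q (t + h) - q t) / h\<bar>) \<longlongrightarrow> \<bar>d\<bar>) (at_right 0)"
    by (rule tendsto_rabs)
  have "\<bar>(q (t + h) - q t) / h\<bar> \<le> K + K' * h" if "h > 0" for h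
    using assms(2)[OF that] that by (simp add: field_simps power2_eq_square)
  then show "\<forall>\<^sub>F h in at_right 0. \<bar>(q (t + h) - q t) / h\<bar> \<le> K + K' * h"
    by (simp add: eventually_at_right_less eventually_mono[OF eventually_at_right_less])
qed simp

text \<open>The difference quotients with steps \<open>s\<close> and \<open>s / 2\<close> differ by
  the second difference with step \<open>s / 2\<close>, divided by \<open>s\<close>, hence by at
  most \<open>K * s / 4\<close>. Summing over \<open>s = h / 2 ^ n\<close> gives
  \<open>K * h / 2\<close>, the constant that Taylor's formula would give if the second derivative
  existed.\<close>

lemma dyadic_remainder_bound:
  fixes q :: "real \<Rightarrow> real"
  assumes d: "(q has_real_derivative d) (at t)"
    and sd: "\<And>h. h > 0 \<Longrightarrow> \<bar>q (t + 2 * h) - 2 * q (t + h) + q t\<bar> \<le> K * h\<^sup>2"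
    and h: "h > 0"
  shows "\<bar>q (t + h) - q t - h * d\<bar> \<le> K / 2 * h\<^sup>2"
proof -
  define D where "D = (\<lambda>h. (q (t + h) - q t) / h)"
  have "K * 1\<^sup>2 \<ge> 0" using sd[of 1] by (smt (verit) zero_less_one)
  then have K: "K \<ge> 0" by simp
  have step: "\<bar>D s - D (s / 2)\<bar> \<le> K * s / 4" if "s > 0" for s
  proof -
    have "D s - D (s / 2) = (q (t + 2 * (s/2)) - 2 * q (t + s/2) + q t) / s"
      using that by (simp add: D_def field_simps)
    also have "\<bar>\<dots>\<bar> \<le> K * (s/2)\<^sup>2 / s"
      using sd[of "s/2"] that by (simp add: abs_divide divide_right_mono)
    also have "\<dots> = K * s / 4" using that by (simp add: power2_eq_square field_simps)
    finally show ?thesis .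
  qed
  have D: "\<bar>D h - D (h / 2 ^ n)\<bar> \<le> K * h / 2 * (1 - 1 / 2 ^ n)" for n
  proof (induction n)
    case (Suc n)
    have "\<bar>D (h / 2 ^ n) - D (h / 2 ^ Suc n)\<bar> \<le> K * (h / 2 ^ n) / 4"
      using step[of "h / 2 ^ n"] h by (simp add: field_simps)
    moreover have "\<bar>D h - D (h / 2 ^ Suc n)\<bar>
        \<le> \<bar>D h - D (h / 2 ^ n)\<bar> + \<bar>D (h / 2 ^ n) - D (h / 2 ^ Suc n)\<bar>"
      by linarith
    moreover have "K * h / 2 * (1 - 1 / 2 ^ n) + K * (h / 2 ^ n) / 4
        = K * h / 2 * (1 - 1 / 2 ^ Suc n)"
      by (simp add: field_simps)
    ultimately show ?case using Suc by linarith
  qed simp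
  have "(D \<longlongrightarrow> d) (at 0)" using d unfolding DERIV_def D_def .
  moreover have "filterlim (\<lambda>n. h / 2 ^ n) (at 0) sequentially"
  proof -
    have "(\<lambda>n. h * (1 / 2) ^ n) \<longlonglongrightarrow> h * 0"
      by (intro tendsto_mult tendsto_const LIMSEQ_realpow_zero) auto
    then show ?thesis using h
      by (auto simp: filterlim_at power_divide)
  qed
  ultimately have "(\<lambda>n. D (h / 2 ^ n)) \<longlonglongrightarrow> d" by (rule filterlim_compose)
  then have "(\<lambda>n. \<bar>D h - D (h / 2 ^ n)\<bar>) \<longlonglongrightarrow> \<bar>D h - d\<bar>"
    by (intro tendsto_intros)
  moreover have "\<bar>D h - D (h / 2 ^ n)\<bar> \<le> K * h / 2" for n
  proof -
    have "K * h / 2 * (1 - 1 / 2 ^ n) \<le> K * h / 2 * 1"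
      using K h by (intro mult_left_mono) auto
    with D[of n] show ?thesis by simp
  qed
  ultimately have "\<bar>D h - d\<bar> \<le> K * h / 2"
    by (intro LIMSEQ_le_const2) auto
  then have "\<bar>D h - d\<bar> * h \<le> K * h / 2 * h" using h by (intro mult_right_mono) auto
  moreover have "\<bar>D h - d\<bar> * h = \<bar>q (t + h) - q t - h * d\<bar>"
  proof -
    have "q (t + h) - q t - h * d = (D h - d) * h" using h by (simp add: D_def field_simps)
    then show ?thesis using h by (simp add: abs_mult)
  qed
  ultimately show ?thesis by (simp add: power2_eq_square)
qed

text \<open>The mean value inequality is applied twice, to the remainder of \<open>y1\<close> and
  then to that of \<open>y\<close>, on the segment between \<open>x\<close> and \<open>z\<close> so
  that both directions are covered. The optimal constant \<open>K / 6\<close> is not sought. A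
  Lipschitz \<open>y2\<close> is all that will be known of \<open>uxx\<close>.\<close>

lemma taylor2_lipschitz:
  fixes y y1 y2 :: "real \<Rightarrow> real"
  assumes x: "x \<in> {a..b}" and z: "z \<in> {a..b}"
    and y: "\<And>x. x \<in> {a..b} \<Longrightarrow> (y has_real_derivative y1 x) (at x within {a..b})"
    and y1: "\<And>x. x \<in> {a..b} \<Longrightarrow> (y1 has_real_derivative y2 x) (at x within {a..b})"
    and lip: "\<And>x z. x \<in> {a..b} \<Longrightarrow> z \<in> {a..b} \<Longrightarrow> \<bar>y2 x - y2 z\<bar> \<le> K * \<bar>x - z\<bar>"
    and "K \<ge> 0"
  shows "\<bar>y z - y x - (z - x) * y1 x - (z - x)\<^sup>2 / 2 * y2 x\<bar> \<le> K * \<bar>z - x\<bar> ^ 3"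
proof -
  define S where "S = closed_segment x z"
  have S: "S \<subseteq> {a..b}" using x z by (auto simp: S_def closed_segment_eq_real_ivl)
  have dist: "\<bar>s - x\<bar> \<le> \<bar>z - x\<bar>" if "s \<in> S" for s
    using that by (auto simp: S_def closed_segment_eq_real_ivl split: if_splits)
  define e1 where "e1 = (\<lambda>s. y1 s - y1 x - (s - x) * y2 x)"
  define e where "e = (\<lambda>s. y s - y x - (s - x) * y1 x - (s - x)\<^sup>2 / 2 * y2 x)"
  have xS: "x \<in> S" "z \<in> S" by (auto simp: S_def)
  have e1: "\<bar>e1 s\<bar> \<le> K * \<bar>z - x\<bar>\<^sup>2" if s: "s \<in> S" for s
  proof -
    have "norm (e1 s - e1 x) \<le> K * \<bar>z - x\<bar> * norm (s - x)"
    proof (rule field_differentiable_bound[where f' = "\<lambda>s. y2 s - y2 x" and S = S])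
      show "convex S" by (simp add: S_def)
      fix r assume r: "r \<in> S"
      show "(e1 has_real_derivative y2 r - y2 x) (at r within S)"
        unfolding e1_def using r S
        by (auto intro!: derivative_eq_intros DERIV_subset[OF y1 S])
      show "norm (y2 r - y2 x) \<le> K * \<bar>z - x\<bar>"
        using lip[of r x] r S x mult_left_mono[OF dist[OF r] \<open>K \<ge> 0\<close>] by auto
    qed (use s xS in auto)
    also have "\<dots> \<le> K * \<bar>z - x\<bar> * \<bar>z - x\<bar>"
      using dist[OF s] \<open>K \<ge> 0\<close> by (intro mult_left_mono) auto
    finally show ?thesis by (simp add: e1_def power2_eq_square)
  qed
  have "norm (e z - e x) \<le> K * \<bar>z - x\<bar>\<^sup>2 * norm (z - x)"
  proof (rule field_differentiable_bound[where f' = e1 and S = S])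
    show "convex S" by (simp add: S_def)
    fix r assume r: "r \<in> S"
    show "(e has_real_derivative e1 r) (at r within S)"
      unfolding e_def e1_def using r S
      by (auto intro!: derivative_eq_intros DERIV_subset[OF y S])
    show "norm (e1 r) \<le> K * \<bar>z - x\<bar>\<^sup>2" using e1[OF r] by simp
  qed (use xS in auto)
  then show ?thesis by (simp add: e_def power3_eq_cube power2_eq_square mult.assoc)
qed

subsection \<open>Regularity of the solution and consistency\<close>

text \<open>\<open>heat_eq\<close> holds up to the ends of the interval, whereas
  \<open>heat_neumann_solution\<close> has it in the interior: the maximum principle evaluates the
  equation at boundary maxima. Continuity of \<open>ut\<close> serves to differentiate the mass
  under the integral.\<close>

locale neumann_heat =
  fixes L \<beta> \<gamma> :: real and f :: "real \<Rightarrow> real" and u ux uxx ut :: "real \<Rightarrow> real \<Rightarrow> real"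
  assumes L_pos: "L > 0"
    and u_cont: "continuous_on ({0..} \<times> {0..L}) (\<lambda>(t, x). u t x)"
    and ut_cont: "continuous_on ({0<..} \<times> {0..L}) (\<lambda>(t, x). ut t x)"
    and ux: "\<And>t x. t > 0 \<Longrightarrow> x \<in> {0..L} \<Longrightarrow> (u t has_real_derivative ux t x) (at x within {0..L})"
    and uxx: "\<And>t x. t > 0 \<Longrightarrow> x \<in> {0..L} \<Longrightarrow> (ux t has_real_derivative uxx t x) (at x within {0..L})"
    and ut: "\<And>t x. t > 0 \<Longrightarrow> x \<in> {0..L} \<Longrightarrow> ((\<lambda>s. u s x) has_real_derivative ut t x) (at t)"
    and bc0: "\<And>t. t > 0 \<Longrightarrow> ux t 0 = \<beta>"
    and bcL: "\<And>t. t > 0 \<Longrightarrow> ux t L = \<gamma>"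
    and heat_eq: "\<And>t x. t > 0 \<Longrightarrow> x \<in> {0..L} \<Longrightarrow> ut t x = uxx t x + f x"

section \<open>Operations on solutions and their consequences\<close>

lemma neumann_heat_diff:
  assumes "neumann_heat L \<beta> \<gamma> f u ux uxx ut" "neumann_heat L \<beta>' \<gamma>' f' v vx vxx vt"
  shows "neumann_heat L (\<beta> - \<beta>') (\<gamma> - \<gamma>') (\<lambda>x. f x - f' x) (\<lambda>t x. u t x - v t x)
    (\<lambda>t x. ux t x - vx t x) (\<lambda>t x. uxx t x - vxx t x) (\<lambda>t x. ut t x - vt t x)"
proof -
  interpret u: neumann_heat L \<beta> \<gamma> f u ux uxx ut by fact
  interpret v: neumann_heat L \<beta>' \<gamma>' f' v vx vxx vt by fact
  show ?thesis
  proof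
    show "continuous_on ({0..} \<times> {0..L}) (\<lambda>(t, x). u t x - v t x)"
      using continuous_on_diff[OF u.u_cont v.u_cont] by (simp add: case_prod_unfold)
    show "continuous_on ({0<..} \<times> {0..L}) (\<lambda>(t, x). ut t x - vt t x)"
      using continuous_on_diff[OF u.ut_cont v.ut_cont] by (simp add: case_prod_unfold)
    show "ut t x - vt t x = uxx t x - vxx t x + (f x - f' x)" if "t > 0" "x \<in> {0..L}" for t x
      using u.heat_eq[OF that] v.heat_eq[OF that] by simp
  qed (auto intro!: DERIV_diff u.ux v.ux u.uxx v.uxx u.ut v.ut
      simp: u.L_pos u.bc0 u.bcL v.bc0 v.bcL)
qed

lemma neumann_heat_shift:
  assumes "neumann_heat L \<beta> \<gamma> f u ux uxx ut" "h \<ge> 0"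
  shows "neumann_heat L \<beta> \<gamma> f (\<lambda>t. u (t + h)) (\<lambda>t. ux (t + h)) (\<lambda>t. uxx (t + h)) (\<lambda>t. ut (t + h))"
proof -
  interpret u: neumann_heat L \<beta> \<gamma> f u ux uxx ut by fact
  show ?thesis
  proof
    have "continuous_on ({0..} \<times> {0..L}) (\<lambda>p. (\<lambda>(t, x). u t x) (fst p + h, snd p))"
      by (rule continuous_on_compose2[OF u.u_cont]) (use \<open>h \<ge> 0\<close> in \<open>auto intro!: continuous_intros\<close>)
    then show "continuous_on ({0..} \<times> {0..L}) (\<lambda>(t, x). u (t + h) x)" by (simp add: case_prod_unfold)
    have "continuous_on ({0<..} \<times> {0..L}) (\<lambda>p. (\<lambda>(t, x). ut t x) (fst p + h, snd p))"
      by (rule continuous_on_compose2[OF u.ut_cont]) (use \<open>h \<ge> 0\<close> in \<open>auto intro!: continuous_intros\<close>)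
    then show "continuous_on ({0<..} \<times> {0..L}) (\<lambda>(t, x). ut (t + h) x)" by (simp add: case_prod_unfold)
  next
    fix t x assume "t > (0::real)" "x \<in> {0..L}"
    then have "((\<lambda>s. u s x) has_real_derivative ut (t + h) x) (at (t + h))"
      using \<open>h \<ge> 0\<close> by (intro u.ut) auto
    then show "((\<lambda>s. u (s + h) x) has_real_derivative ut (t + h) x) (at t)"
      by (simp add: DERIV_shift)
  qed (use \<open>h \<ge> 0\<close> in \<open>auto intro!: u.ux u.uxx simp: u.L_pos u.bc0 u.bcL u.heat_eq\<close>)
qed

lemma homogeneous_neumann_heat_bound:
  assumes "neumann_heat L 0 0 (\<lambda>x. 0) w wx wxx wt"
    and "\<And>x. x \<in> {0..L} \<Longrightarrow> \<bar>w 0 x\<bar> \<le> m" "t \<ge> 0" "x \<in> {0..L}"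
  shows "\<bar>w t x\<bar> \<le> m"
proof -
  interpret neumann_heat L 0 0 "\<lambda>x. 0" w wx wxx wt by fact
  show ?thesis
    using neumann_maximum_principle_abs[OF L_pos u_cont ux uxx ut bc0 bcL, of 0 0 m t x] assms(2-)
    by (auto simp: heat_eq)
qed

text \<open>The scheme starts at time 0, where no derivative of \<open>u\<close> is available.
  Consistency errors are written with values of \<open>u\<close> alone so that this limit reaches
  the first step.\<close>

lemma abs_le_of_pos_abs_le:
  fixes \<phi> :: "real \<Rightarrow> real"
  assumes "continuous_on {0..} \<phi>" "\<And>t. t > 0 \<Longrightarrow> \<bar>\<phi> t\<bar> \<le> C" "t \<ge> 0"
  shows "\<bar>\<phi> t\<bar> \<le> C"
proof (cases "t = 0")
  case True
  have "(\<phi> \<longlongrightarrow> \<phi> 0) (at 0 within {0..})" using assms(1) by (simp add: continuous_on)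
  then have "(\<phi> \<longlongrightarrow> \<phi> 0) (at_right 0)" by (rule tendsto_within_subset) auto
  then have "((\<lambda>t. \<bar>\<phi> t\<bar>) \<longlongrightarrow> \<bar>\<phi> 0\<bar>) (at_right 0)" by (rule tendsto_rabs)
  moreover have "\<forall>\<^sub>F t in at_right 0. \<bar>\<phi> t\<bar> \<le> C"
    using assms(2) by (rule eventually_mono[OF eventually_at_right_less])
  ultimately show ?thesis using True by (auto intro: tendsto_upperbound)
qed (use assms in auto)

context neumann_heat
begin

text \<open>Source and boundary data are independent of time and cancel. The increment is again an
  instance of the locale, so interpreting it allows a further increment; second and mixed
  differences arise in this way.\<close>

lemma increment: "h \<ge> 0 \<Longrightarrow> neumann_heat L 0 0 (\<lambda>x. 0) (\<lambda>t x. u (t + h) x - u t x)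
    (\<lambda>t x. ux (t + h) x - ux t x) (\<lambda>t x. uxx (t + h) x - uxx t x) (\<lambda>t x. ut (t + h) x - ut t x)"
  using neumann_heat_diff[OF neumann_heat_shift[OF neumann_heat_axioms] neumann_heat_axioms, of h]
  by simp

lemma u_cont_time: "x \<in> {0..L} \<Longrightarrow> s \<ge> 0 \<Longrightarrow> continuous_on {0..} (\<lambda>t. u (t + s) x)"
  by (rule continuous_on_compose2[OF u_cont, of "{0..}" "\<lambda>t. (t + s, x)", simplified])
    (auto intro!: continuous_intros)

lemma u_cont_time': "x \<in> {0..L} \<Longrightarrow> continuous_on {0..} (\<lambda>t. u t x)"
  using u_cont_time[of x 0] by simp

lemma mass_conservation:
  assumes "\<gamma> - \<beta> + integral {0..L} f = 0" "f integrable_on {0..L}" "t \<ge> 0"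
  shows "integral {0..L} (u t) = integral {0..L} (u 0)"
proof (cases "t = 0")
  case False
  then have "t > 0" using assms by simp
  define I where "I = (\<lambda>t. integral {0..L} (u t))"
  have u_int: "u s integrable_on {0..L}" if "s > 0" for s
    using that by (intro integrable_continuous_real DERIV_continuous_on[OF ux]) auto
  \<comment> \<open>The derivative vanishes for positive times; continuity of the mass at time 0
    connects it to the initial value.\<close>
  have "I t = I 0"
  proof (rule DERIV_isconst2[OF \<open>t > 0\<close>])
    have "continuous_on {0..t} (\<lambda>t. integral (cbox 0 L) (u t))"
      by (rule integral_continuous_on_param, rule continuous_on_subset[OF u_cont]) auto
    then show "continuous_on {0..t} I" by (simp add: I_def)
    fix s assume s: "0 < s" "s < t"
    have "((\<lambda>s. integral (cbox 0 L) (u s)) has_real_derivative integral (cbox 0 L) (ut s)) (at s within {0<..})"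
      by (rule leibniz_rule_field_derivative)
        (use s ut_cont u_int in \<open>auto intro: has_field_derivative_at_within[OF ut]\<close>)
    then have D: "(I has_real_derivative integral {0..L} (ut s)) (at s)"
      using s by (simp add: I_def at_within_open[of s "{0<..}"])
    have "(uxx s has_integral ux s L - ux s 0) {0..L}"
      using L_pos s by (intro fundamental_theorem_of_calculus)
        (auto simp: has_real_derivative_iff_has_vector_derivative[symmetric] intro: uxx)
    then have "((\<lambda>x. uxx s x + f x) has_integral (\<gamma> - \<beta>) + integral {0..L} f) {0..L}"
      using assms(2) s by (intro has_integral_add) (auto simp: bc0 bcL integrable_integral)
    then have "(ut s has_integral (\<gamma> - \<beta>) + integral {0..L} f) {0..L}"
      by (rule has_integral_eq_rhs[OF has_integral_eq, rotated]) (use s heat_eq in auto)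
    then have "integral {0..L} (ut s) = 0" using assms(1) by (simp add: integral_unique)
    then show "(I has_real_derivative 0) (at s)" using D by simp
  qed (use \<open>t > 0\<close> in auto)
  then show ?thesis by (simp add: I_def)
qed auto

end

text \<open>\<open>U1\<close>, \<open>U2\<close> are the derivatives of the initial value, and
  \<open>G1\<close>, \<open>G2\<close> those of \<open>U2 + f\<close>, the time derivative expected
  at time 0. Thus \<open>N\<close> bounds the initial \<open>ut\<close> and \<open>M\<close> the
  initial second time derivative. \<open>G1_bc\<close> says that \<open>U2 + f\<close> is compatible
  with homogeneous Neumann conditions.\<close>

locale neumann_heat_regular = neumann_heat +
  fixes U1 U2 G1 G2 :: "real \<Rightarrow> real" and M N R R1 :: real
  assumes U1: "\<And>x. x \<in> {0..L} \<Longrightarrow> (u 0 has_real_derivative U1 x) (at x within {0..L})"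
    and U2: "\<And>x. x \<in> {0..L} \<Longrightarrow> (U1 has_real_derivative U2 x) (at x within {0..L})"
    and G1: "\<And>x. x \<in> {0..L} \<Longrightarrow> ((\<lambda>x. U2 x + f x) has_real_derivative G1 x) (at x within {0..L})"
    and G2: "\<And>x. x \<in> {0..L} \<Longrightarrow> (G1 has_real_derivative G2 x) (at x within {0..L})"
    and U1_bc: "U1 0 = \<beta>" "U1 L = \<gamma>" and G1_bc: "G1 0 = 0" "G1 L = 0"
    and M: "\<And>x. x \<in> {0..L} \<Longrightarrow> \<bar>G2 x\<bar> \<le> M"
    and N: "\<And>x. x \<in> {0..L} \<Longrightarrow> \<bar>U2 x + f x\<bar> \<le> N"
    and R: "\<And>x. x \<in> {0..L} \<Longrightarrow> \<bar>f x\<bar> \<le> R"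
    and R1: "\<And>x y. x \<in> {0..L} \<Longrightarrow> y \<in> {0..L} \<Longrightarrow> \<bar>f x - f y\<bar> \<le> R1 * \<bar>x - y\<bar>"
begin

lemma nonneg: "M \<ge> 0" "N \<ge> 0" "R \<ge> 0" "R1 \<ge> 0"
proof -
  have "0 \<le> R1 * L" using R1[of 0 L] L_pos by (auto intro: order_trans[OF abs_ge_zero])
  then show "R1 \<ge> 0" using L_pos by (simp add: zero_le_mult_iff)
qed (use M[of 0] N[of 0] R[of 0] L_pos in auto)

lemma u_expansion_at_0:
  assumes "t \<ge> 0" "x \<in> {0..L}"
  shows "\<bar>u t x - u 0 x - t * (U2 x + f x)\<bar> \<le> M / 2 * t\<^sup>2"
proof -
  define G where "G = (\<lambda>x. U2 x + f x)"
  have G_cont: "continuous_on {0..L} G" "continuous_on {0..L} (u 0)"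
    using DERIV_continuous_on[OF G1] DERIV_continuous_on[OF U1] by (auto simp: G_def)
  have c0: "continuous_on ({0..} \<times> {0..L}) (\<lambda>p. G (snd p))" "continuous_on ({0..} \<times> {0..L}) (\<lambda>p. u 0 (snd p))"
    by (rule continuous_on_compose2[OF G_cont(1)], auto intro!: continuous_intros)
      (rule continuous_on_compose2[OF G_cont(2)], auto intro!: continuous_intros)
  have "\<bar>u t x - u 0 x - t * G x\<bar> \<le> 0 + 0 * t + M * t\<^sup>2 / 2"
  proof (rule neumann_maximum_principle_abs[where w = "\<lambda>t x. u t x - u 0 x - t * G x"
        and wx = "\<lambda>t x. ux t x - U1 x - t * G1 x" and wxx = "\<lambda>t x. uxx t x - U2 x - t * G2 x"
        and wt = "\<lambda>t x. ut t x - G x", OF L_pos _ _ _ _ _ _ _ _ assms])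
    show "continuous_on ({0..} \<times> {0..L}) (\<lambda>(t, x). u t x - u 0 x - t * G x)"
      using continuous_on_diff[OF continuous_on_diff[OF u_cont c0(2)]
          continuous_on_mult[OF continuous_on_fst[OF continuous_on_id] c0(1)]]
      by (simp add: case_prod_unfold)
  next
    fix t x assume tx: "t > (0::real)" "x \<in> {0..L}"
    show "((\<lambda>x. u t x - u 0 x - t * G x) has_real_derivative ux t x - U1 x - t * G1 x) (at x within {0..L})"
      unfolding G_def using tx by (intro DERIV_diff DERIV_cmult ux U1 G1)
    show "((\<lambda>x. ux t x - U1 x - t * G1 x) has_real_derivative uxx t x - U2 x - t * G2 x) (at x within {0..L})"
      using tx by (intro DERIV_diff DERIV_cmult uxx U2 G2)
    show "((\<lambda>s. u s x - u 0 x - s * G x) has_real_derivative ut t x - G x) (at t)"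
      using tx by (auto intro!: derivative_eq_intros ut)
    show "\<bar>ut t x - G x - (uxx t x - U2 x - t * G2 x)\<bar> \<le> M * t + 0"
      using tx M[OF tx(2)] by (simp add: heat_eq G_def abs_mult)
  qed (simp_all add: bc0 bcL U1_bc G1_bc)
  then show ?thesis by (simp add: G_def)
qed

lemma u_minus_initial_bound:
  assumes "t \<ge> 0" "x \<in> {0..L}"
  shows "\<bar>u t x - u 0 x\<bar> \<le> N * t"
proof -
  have cont: "continuous_on {0..L} (u 0)" using DERIV_continuous_on[OF U1] by auto
  have c0: "continuous_on ({0..} \<times> {0..L}) (\<lambda>p. u 0 (snd p))"
    by (rule continuous_on_compose2[OF cont]) (auto intro!: continuous_intros)
  have "\<bar>u t x - u 0 x\<bar> \<le> 0 + N * t + 0 * t\<^sup>2 / 2"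
  proof (rule neumann_maximum_principle_abs[where w = "\<lambda>t x. u t x - u 0 x"
        and wx = "\<lambda>t x. ux t x - U1 x" and wxx = "\<lambda>t x. uxx t x - U2 x"
        and wt = ut, OF L_pos _ _ _ _ _ _ _ _ assms])
    show "continuous_on ({0..} \<times> {0..L}) (\<lambda>(t, x). u t x - u 0 x)"
      using continuous_on_diff[OF u_cont c0] by (simp add: case_prod_unfold)
  next
    fix t x assume tx: "t > (0::real)" "x \<in> {0..L}"
    show "((\<lambda>s. u s x - u 0 x) has_real_derivative ut t x) (at t)"
      using tx by (auto intro!: derivative_eq_intros ut)
    show "\<bar>ut t x - (uxx t x - U2 x)\<bar> \<le> 0 * t + N"
      using tx N[OF tx(2)] by (simp add: heat_eq add.commute)
  qed (auto intro!: DERIV_diff ux U1 uxx U2 simp: bc0 bcL U1_bc)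
  then show ?thesis by simp
qed

lemma u_time_lipschitz:
  assumes "t \<ge> 0" "h \<ge> 0" "x \<in> {0..L}"
  shows "\<bar>u (t + h) x - u t x\<bar> \<le> N * h"
  by (rule homogeneous_neumann_heat_bound[OF increment[OF assms(2)], of _ t x])
    (use assms u_minus_initial_bound[of h] in auto)

lemma ut_bound: "t > 0 \<Longrightarrow> x \<in> {0..L} \<Longrightarrow> \<bar>ut t x\<bar> \<le> N"
  by (rule DERIV_abs_bound[OF ut, of t x N 0]) (use u_time_lipschitz[of t _ x] in auto)

text \<open>At time 0 the linear terms of the two expansions cancel; the remainder at
  \<open>2 * h\<close> contributes \<open>2 * M * h\<^sup>2\<close> and twice the one at
  \<open>h\<close> another \<open>M * h\<^sup>2\<close>. Being an increment of an increment, the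
  second difference inherits the bound at later times.\<close>

lemma second_difference_bound:
  assumes "t \<ge> 0" "h \<ge> 0" "x \<in> {0..L}"
  shows "\<bar>u (t + 2 * h) x - 2 * u (t + h) x + u t x\<bar> \<le> 3 * M * h\<^sup>2"
proof -
  interpret w: neumann_heat L 0 0 "\<lambda>x. 0" "\<lambda>t x. u (t + h) x - u t x"
    "\<lambda>t x. ux (t + h) x - ux t x" "\<lambda>t x. uxx (t + h) x - uxx t x" "\<lambda>t x. ut (t + h) x - ut t x"
    by (rule increment[OF assms(2)])
  have "\<bar>(u (t + h + h) x - u (t + h) x) - (u (t + h) x - u t x)\<bar> \<le> 3 * M * h\<^sup>2"
  proof (rule homogeneous_neumann_heat_bound[OF w.increment[OF assms(2)] _ assms(1,3)])
    fix x assume x: "x \<in> {0..L}"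
    have "\<bar>u (h + h) x - u 0 x - 2 * (h * (U2 x + f x))\<bar> \<le> 2 * (M * h\<^sup>2)"
      using u_expansion_at_0[of "h + h" x] x assms(2) by (simp add: power2_eq_square algebra_simps)
    moreover have "\<bar>u h x - u 0 x - h * (U2 x + f x)\<bar> \<le> (M * h\<^sup>2) / 2"
      using u_expansion_at_0[of h x] x assms(2) by simp
    ultimately show "\<bar>u (0 + h + h) x - u (0 + h) x - (u (0 + h) x - u 0 x)\<bar> \<le> 3 * M * h\<^sup>2"
      unfolding add_0 mult.assoc by linarith
  qed
  then show ?thesis by (simp add: algebra_simps)
qed

lemma u_time_expansion:
  assumes "t > 0" "h > 0" "x \<in> {0..L}"
  shows "\<bar>u (t + h) x - u t x - h * ut t x\<bar> \<le> 3 / 2 * M * h\<^sup>2"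
  using dyadic_remainder_bound[OF ut[OF assms(1,3)], of "3 * M" h] second_difference_bound[of t _ x] assms
  by simp

text \<open>Continuity of \<open>ut\<close> at time 0 is not given, so \<open>ut\<close> is reached
  through values of \<open>u\<close>: the expansions from 0 to \<open>2 * h\<close>, from 0 to
  \<open>h\<close> and from \<open>h\<close> to \<open>2 * h\<close> combine so that all values of
  \<open>u\<close> cancel. The constant is 2 + 1/2 + 3/2.\<close>

lemma ut_minus_initial_bound:
  assumes h: "h > 0" and x: "x \<in> {0..L}"
  shows "\<bar>ut h x - (U2 x + f x)\<bar> \<le> 4 * M * h"
proof -
  have "\<bar>u (h + h) x - u 0 x - 2 * (h * (U2 x + f x))\<bar> \<le> 2 * (M * h\<^sup>2)"
    using u_expansion_at_0[of "h + h" x] x h by (simp add: power2_eq_square algebra_simps)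
  moreover have "\<bar>u h x - u 0 x - h * (U2 x + f x)\<bar> \<le> (M * h\<^sup>2) / 2"
    using u_expansion_at_0[of h x] x h by simp
  moreover have "\<bar>u (h + h) x - u h x - h * ut h x\<bar> \<le> 3 / 2 * (M * h\<^sup>2)"
    using u_time_expansion[OF h h x] by simp
  ultimately have "\<bar>h * ut h x - h * (U2 x + f x)\<bar> \<le> 4 * (M * h\<^sup>2)"
    by linarith
  then have "\<bar>h * (ut h x - (U2 x + f x))\<bar> \<le> 4 * M * h * h"
    by (simp add: right_diff_distrib power2_eq_square mult.assoc)
  then show ?thesis using h by (simp add: abs_mult)
qed

text \<open>Here the steps \<open>h\<close> and \<open>s\<close> are independent and the bound is a
  product. Dividing by \<open>h\<close> and letting it tend to 0 with \<open>s\<close> fixed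
  therefore yields a Lipschitz bound for \<open>ut\<close>.\<close>

lemma mixed_difference_bound:
  assumes "t \<ge> 0" "s \<ge> 0" "h > 0" "x \<in> {0..L}"
  shows "\<bar>(u (t + s + h) x - u (t + s) x) - (u (t + h) x - u t x)\<bar> \<le> 4 * M * h * s"
proof -
  have h0: "h \<ge> 0" using assms by simp
  interpret w: neumann_heat L 0 0 "\<lambda>x. 0" "\<lambda>t x. u (t + h) x - u t x"
    "\<lambda>t x. ux (t + h) x - ux t x" "\<lambda>t x. uxx (t + h) x - uxx t x" "\<lambda>t x. ut (t + h) x - ut t x"
    by (rule increment[OF h0])
  have dh: "((\<lambda>x. u h x - u 0 x) has_real_derivative ux h x - U1 x) (at x within {0..L})"
    "((\<lambda>x. ux h x - U1 x) has_real_derivative uxx h x - U2 x) (at x within {0..L})" if "x \<in> {0..L}" for x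
    using that assms by (auto intro!: DERIV_diff ux U1 uxx U2)
  have cont: "continuous_on {0..L} (\<lambda>x. u h x - u 0 x)" using DERIV_continuous_on[OF dh(1)] by auto
  have c0: "continuous_on ({0..} \<times> {0..L}) (\<lambda>p. u h (snd p) - u 0 (snd p))"
    by (rule continuous_on_compose2[OF cont]) (auto intro!: continuous_intros)
  \<comment> \<open>Time 0 comes first. As a function of \<open>s\<close> the mixed difference
    starts at zero with zero slopes at the ends, and its source \<open>uxx h x - U2 x\<close> is
    \<open>ut h x - (U2 x + f x)\<close> by the heat equation, hence at most
    \<open>4 * M * h\<close> in size.\<close>
  have init: "\<bar>(u (s + h) x - u s x) - (u h x - u 0 x)\<bar> \<le> 0 + 4 * M * h * s + 0 * s\<^sup>2 / 2" if x: "x \<in> {0..L}" for x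
  proof (rule neumann_maximum_principle_abs[where w = "\<lambda>t x. (u (t + h) x - u t x) - (u h x - u 0 x)"
        and wx = "\<lambda>t x. (ux (t + h) x - ux t x) - (ux h x - U1 x)"
        and wxx = "\<lambda>t x. (uxx (t + h) x - uxx t x) - (uxx h x - U2 x)"
        and wt = "\<lambda>t x. ut (t + h) x - ut t x", OF L_pos _ _ _ _ _ _ _ _ assms(2) x])
    show "continuous_on ({0..} \<times> {0..L}) (\<lambda>(t, x). (u (t + h) x - u t x) - (u h x - u 0 x))"
      using continuous_on_diff[OF w.u_cont c0] by (simp add: case_prod_unfold)
  next
    fix t x assume tx: "t > (0::real)" "x \<in> {0..L}"
    show "((\<lambda>x. (u (t + h) x - u t x) - (u h x - u 0 x)) has_real_derivative
        (ux (t + h) x - ux t x) - (ux h x - U1 x)) (at x within {0..L})"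
      by (intro DERIV_diff[OF w.ux dh(1)] tx)
    show "((\<lambda>x. (ux (t + h) x - ux t x) - (ux h x - U1 x)) has_real_derivative
        (uxx (t + h) x - uxx t x) - (uxx h x - U2 x)) (at x within {0..L})"
      by (intro DERIV_diff[OF w.uxx dh(2)] tx)
    show "((\<lambda>s. (u (s + h) x - u s x) - (u h x - u 0 x)) has_real_derivative ut (t + h) x - ut t x) (at t)"
      using DERIV_diff[OF w.ut[OF tx] DERIV_const] by simp
    show "\<bar>(ut (t + h) x - ut t x) - ((uxx (t + h) x - uxx t x) - (uxx h x - U2 x))\<bar> \<le> 0 * t + 4 * M * h"
      using ut_minus_initial_bound[OF \<open>h > 0\<close> tx(2)] tx assms by (simp add: heat_eq algebra_simps)
  qed (use assms in \<open>simp_all add: bc0 bcL U1_bc\<close>)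
  have "\<bar>(u (t + s + h) x - u (t + s) x) - (u (t + h) x - u t x)\<bar> \<le> 4 * M * h * s"
    by (rule homogeneous_neumann_heat_bound[OF w.increment[OF assms(2)] _ assms(1,4)])
      (use init in simp)
  then show ?thesis .
qed

lemma ut_time_lipschitz:
  assumes "t > 0" "s \<ge> 0" "x \<in> {0..L}"
  shows "\<bar>ut (t + s) x - ut t x\<bar> \<le> 4 * M * s"
proof (rule DERIV_abs_bound)
  interpret w: neumann_heat L 0 0 "\<lambda>x. 0" "\<lambda>t x. u (t + s) x - u t x"
    "\<lambda>t x. ux (t + s) x - ux t x" "\<lambda>t x. uxx (t + s) x - uxx t x" "\<lambda>t x. ut (t + s) x - ut t x"
    by (rule increment[OF assms(2)])
  show "((\<lambda>t. u (t + s) x - u t x) has_real_derivative ut (t + s) x - ut t x) (at t)"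
    by (rule w.ut[OF assms(1,3)])
  fix h :: real assume "h > 0"
  then show "\<bar>(u (t + h + s) x - u (t + h) x) - (u (t + s) x - u t x)\<bar> \<le> 4 * M * s * h + 0 * h\<^sup>2"
    using mixed_difference_bound[of t s h x] assms by (simp add: algebra_simps)
qed

text \<open>There is no x-derivative of \<open>ut\<close> to bound. Instead, the increment of
  \<open>ux\<close> over a time step \<open>h\<close> vanishes at the left end and has x-derivative
  equal to the increment of \<open>ut\<close>, at most \<open>4 * M * h\<close>; integrating twice
  in space and dividing by \<open>h\<close> gives the claim.\<close>

lemma ut_space_lipschitz:
  assumes t: "t > 0" and x: "x \<in> {0..L}" and y: "y \<in> {0..L}"
  shows "\<bar>ut t x - ut t y\<bar> \<le> 4 * M * L * \<bar>x - y\<bar>"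
proof (rule DERIV_abs_bound)
  show "((\<lambda>t. u t x - u t y) has_real_derivative ut t x - ut t y) (at t)"
    by (intro DERIV_diff ut assms)
  fix h :: real assume h: "h > 0"
  interpret w: neumann_heat L 0 0 "\<lambda>x. 0" "\<lambda>t x. u (t + h) x - u t x"
    "\<lambda>t x. ux (t + h) x - ux t x" "\<lambda>t x. uxx (t + h) x - uxx t x" "\<lambda>t x. ut (t + h) x - ut t x"
    using h by (intro increment) simp
  have wx: "\<bar>ux (t + h) z - ux t z\<bar> \<le> 4 * M * h * L" if z: "z \<in> {0..L}" for z
  proof -
    have "norm ((ux (t + h) z - ux t z) - (ux (t + h) 0 - ux t 0)) \<le> 4 * M * h * norm (z - 0)"
    proof (rule field_differentiable_bound[where S = "{0..L}"])
      fix r assume r: "r \<in> {0..L}"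
      show "((\<lambda>z. ux (t + h) z - ux t z) has_real_derivative uxx (t + h) r - uxx t r) (at r within {0..L})"
        by (rule w.uxx[OF t r])
      show "norm (uxx (t + h) r - uxx t r) \<le> 4 * M * h"
        using w.heat_eq[OF t r] ut_time_lipschitz[of t h r] t h r by simp
    qed (use z L_pos in auto)
    also have "\<dots> \<le> 4 * M * h * L" using z nonneg h by (intro mult_left_mono) auto
    finally show ?thesis using t h by (simp add: bc0)
  qed
  have "norm ((u (t + h) x - u t x) - (u (t + h) y - u t y)) \<le> 4 * M * h * L * norm (x - y)"
    by (rule field_differentiable_bound[where S = "{0..L}", OF _ w.ux[OF t]]) (use wx x y in auto)
  then show "\<bar>(u (t + h) x - u (t + h) y) - (u t x - u t y)\<bar> \<le> 4 * M * L * \<bar>x - y\<bar> * h + 0 * h\<^sup>2"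
    by (simp add: algebra_simps)
qed

lemma uxx_lipschitz:
  assumes "t > 0" "x \<in> {0..L}" "y \<in> {0..L}"
  shows "\<bar>uxx t x - uxx t y\<bar> \<le> (4 * M * L + R1) * \<bar>x - y\<bar>"
  using ut_space_lipschitz[OF assms] R1[OF assms(2,3)] heat_eq[of t x] heat_eq[of t y] assms
  by (simp add: algebra_simps)

lemma u_taylor:
  assumes "t > 0" "x \<in> {0..L}" "z \<in> {0..L}"
  shows "\<bar>u t z - u t x - (z - x) * ux t x - (z - x)\<^sup>2 / 2 * uxx t x\<bar> \<le> (4 * M * L + R1) * \<bar>z - x\<bar> ^ 3"
  by (rule taylor2_lipschitz[OF assms(2,3)])
    (use assms ux uxx uxx_lipschitz nonneg L_pos in auto)

text \<open>Input for the quadrature estimate of the mean. By the equation \<open>uxx - U2\<close>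
  is \<open>ut\<close> minus \<open>U2 + f\<close>, hence at most \<open>2 * N\<close>, and the
  slopes of \<open>u t\<close> and \<open>u 0\<close> agree at the left end.\<close>

lemma space_lipschitz_minus_initial:
  assumes t: "t > 0" and x: "x \<in> {0..L}" and y: "y \<in> {0..L}"
  shows "\<bar>(u t x - u 0 x) - (u t y - u 0 y)\<bar> \<le> 2 * N * L * \<bar>x - y\<bar>"
proof -
  have w1: "\<bar>ux t z - U1 z\<bar> \<le> 2 * N * L" if z: "z \<in> {0..L}" for z
  proof -
    have "norm ((ux t z - U1 z) - (ux t 0 - U1 0)) \<le> 2 * N * norm (z - 0)"
    proof (rule field_differentiable_bound[where S = "{0..L}"])
      fix r assume r: "r \<in> {0..L}"
      show "((\<lambda>z. ux t z - U1 z) has_real_derivative uxx t r - U2 r) (at r within {0..L})"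
        by (intro DERIV_diff uxx U2 t r)
      show "norm (uxx t r - U2 r) \<le> 2 * N"
        using heat_eq[OF t r] ut_bound[OF t r] N[OF r] by simp
    qed (use z L_pos in auto)
    also have "\<dots> \<le> 2 * N * L" using z nonneg by (intro mult_left_mono) auto
    finally show ?thesis using t by (simp add: bc0 U1_bc)
  qed
  have "norm ((u t x - u 0 x) - (u t y - u 0 y)) \<le> 2 * N * L * norm (x - y)"
    by (rule field_differentiable_bound[where S = "{0..L}" and f' = "\<lambda>z. ux t z - U1 z"])
      (use w1 x y t in \<open>auto intro!: DERIV_diff ux U1\<close>)
  then show ?thesis by simp
qed

section \<open>Truncation errors at interior and boundary nodes\<close>

lemma time_quotient:
  assumes "t > 0" "d > 0" "x \<in> {0..L}"
  shows "\<bar>(u (t + d) x - u t x) / d - f x - uxx t x\<bar> \<le> 3 / 2 * M * d"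
proof -
  have "(u (t + d) x - u t x) / d - f x - uxx t x = (u (t + d) x - u t x - d * ut t x) / d"
    using assms by (simp add: heat_eq field_simps)
  also have "\<bar>\<dots>\<bar> \<le> 3 / 2 * M * d\<^sup>2 / d"
    unfolding abs_divide abs_of_pos[OF assms(2)]
    using u_time_expansion[OF assms] assms(2) by (intro divide_right_mono) auto
  finally show ?thesis using assms by (simp add: power2_eq_square)
qed

lemma consistency_interior:
  assumes t: "t \<ge> 0" and d: "d > 0" and h: "h > 0" and x: "x - h \<ge> 0" "x + h \<le> L"
  shows "\<bar>(u (t + d) x - u t x) / d - f x - (u t (x + h) - 2 * u t x + u t (x - h)) / h\<^sup>2\<bar>
    \<le> 3 / 2 * M * d + 2 * (4 * M * L + R1) * h"
proof (rule abs_le_of_pos_abs_le[where \<phi> = "\<lambda>t. (u (t + d) x - u t x) / d - f x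
      - (u t (x + h) - 2 * u t x + u t (x - h)) / h\<^sup>2"])
  have mem: "x \<in> {0..L}" "x + h \<in> {0..L}" "x - h \<in> {0..L}" using x h by auto
  show "continuous_on {0..} (\<lambda>t. (u (t + d) x - u t x) / d - f x
      - (u t (x + h) - 2 * u t x + u t (x - h)) / h\<^sup>2)"
    using d h mem by (intro continuous_intros u_cont_time u_cont_time') auto
  fix t :: real assume t: "t > 0"
  have "(u t (x + h) - 2 * u t x + u t (x - h)) / h\<^sup>2 - uxx t x
      = (u t (x + h) - 2 * u t x + u t (x - h) - h\<^sup>2 * uxx t x) / h\<^sup>2"
    using h by (simp add: field_simps)
  also have "\<bar>\<dots>\<bar> \<le> (2 * (4 * M * L + R1) * h ^ 3) / h\<^sup>2"
  proof -
    define k where "k = (4 * M * L + R1) * h ^ 3"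
    have "\<bar>u t (x + h) - u t x - h * ux t x - h\<^sup>2 * uxx t x / 2\<bar> \<le> k"
      "\<bar>u t (x - h) - u t x + h * ux t x - h\<^sup>2 * uxx t x / 2\<bar> \<le> k"
      using u_taylor[OF t mem(1,2)] u_taylor[OF t mem(1,3)] h by (simp_all add: k_def)
    then have "\<bar>u t (x + h) - 2 * u t x + u t (x - h) - h\<^sup>2 * uxx t x\<bar> \<le> 2 * k" by linarith
    then have "\<bar>u t (x + h) - 2 * u t x + u t (x - h) - h\<^sup>2 * uxx t x\<bar> / h\<^sup>2 \<le> 2 * k / h\<^sup>2"
      by (intro divide_right_mono) auto
    then show ?thesis unfolding k_def abs_divide abs_power2 mult.assoc .
  qed
  also have "\<dots> = 2 * (4 * M * L + R1) * h" using h by (simp add: power2_eq_square power3_eq_cube)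
  finally show "\<bar>(u (t + d) x - u t x) / d - f x - (u t (x + h) - 2 * u t x + u t (x - h)) / h\<^sup>2\<bar>
    \<le> 3 / 2 * M * d + 2 * (4 * M * L + R1) * h"
    using time_quotient[OF t d mem(1)] by linarith
qed (rule t)

text \<open>At a boundary node the scheme only sees half of \<open>uxx\<close>.\<close>
lemma consistency_left:
  assumes t: "t \<ge> 0" and d: "d > 0" and h: "h > 0" "h \<le> L"
  shows "\<bar>((u (t + d) 0 - u t 0) / d - f 0) / 2 - (u t h - u t 0 - h * \<beta>) / h\<^sup>2\<bar>
    \<le> 3 / 2 * M * d + 2 * (4 * M * L + R1) * h"
proof (rule abs_le_of_pos_abs_le[where \<phi> = "\<lambda>t. ((u (t + d) 0 - u t 0) / d - f 0) / 2
      - (u t h - u t 0 - h * \<beta>) / h\<^sup>2"])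
  have mem: "0 \<in> {0..L}" "h \<in> {0..L}" using h by auto
  show "continuous_on {0..} (\<lambda>t. ((u (t + d) 0 - u t 0) / d - f 0) / 2 - (u t h - u t 0 - h * \<beta>) / h\<^sup>2)"
    using d h mem by (intro continuous_intros u_cont_time u_cont_time') auto
  fix t :: real assume t: "t > 0"
  have "(u t h - u t 0 - h * \<beta>) / h\<^sup>2 - uxx t 0 / 2 = (u t h - u t 0 - h * \<beta> - h\<^sup>2 / 2 * uxx t 0) / h\<^sup>2"
    using h by (simp add: field_simps)
  also have "\<bar>\<dots>\<bar> \<le> ((4 * M * L + R1) * h ^ 3) / h\<^sup>2"
    using u_taylor[OF t mem] h t by (simp add: abs_divide divide_right_mono bc0)
  also have "\<dots> = (4 * M * L + R1) * h" using h by (simp add: power2_eq_square power3_eq_cube)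
  finally have space: "\<bar>(u t h - u t 0 - h * \<beta>) / h\<^sup>2 - uxx t 0 / 2\<bar> \<le> (4 * M * L + R1) * h" .
  have "(4 * M * L + R1) * h \<ge> 0" "M * d \<ge> 0" using nonneg h d L_pos by auto
  \<comment> \<open>The bound is relaxed to the one for interior nodes, so that a single constant
    serves all of them.\<close>
  moreover have "\<bar>q / 2 - p\<bar> \<le> 3 / 2 * e + 2 * k"
    if "0 \<le> k" "0 \<le> e" "\<bar>p - w / 2\<bar> \<le> k" "\<bar>q - w\<bar> \<le> 3 / 2 * e" for p q w e k :: real
    using that by linarith
  moreover note space time_quotient[OF t d mem(1), unfolded mult.assoc]
  ultimately show "\<bar>((u (t + d) 0 - u t 0) / d - f 0) / 2 - (u t h - u t 0 - h * \<beta>) / h\<^sup>2\<bar>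
    \<le> 3 / 2 * M * d + 2 * (4 * M * L + R1) * h"
    unfolding mult.assoc by blast
qed (rule t)

lemma consistency_right:
  assumes t: "t \<ge> 0" and d: "d > 0" and h: "h > 0" "h \<le> L"
  shows "\<bar>((u (t + d) L - u t L) / d - f L) / 2 - (u t (L - h) - u t L + h * \<gamma>) / h\<^sup>2\<bar>
    \<le> 3 / 2 * M * d + 2 * (4 * M * L + R1) * h"
proof (rule abs_le_of_pos_abs_le[where \<phi> = "\<lambda>t. ((u (t + d) L - u t L) / d - f L) / 2
      - (u t (L - h) - u t L + h * \<gamma>) / h\<^sup>2"])
  have mem: "L \<in> {0..L}" "L - h \<in> {0..L}" using h by auto
  show "continuous_on {0..} (\<lambda>t. ((u (t + d) L - u t L) / d - f L) / 2 - (u t (L - h) - u t L + h * \<gamma>) / h\<^sup>2)"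
    using d h mem by (intro continuous_intros u_cont_time u_cont_time') auto
  fix t :: real assume t: "t > 0"
  have "(u t (L - h) - u t L + h * \<gamma>) / h\<^sup>2 - uxx t L / 2
      = (u t (L - h) - u t L + h * \<gamma> - h\<^sup>2 / 2 * uxx t L) / h\<^sup>2"
    using h by (simp add: field_simps)
  also have "\<bar>\<dots>\<bar> \<le> ((4 * M * L + R1) * h ^ 3) / h\<^sup>2"
    using u_taylor[OF t mem] h t by (simp add: abs_divide divide_right_mono bcL)
  also have "\<dots> = (4 * M * L + R1) * h" using h by (simp add: power2_eq_square power3_eq_cube)
  finally have space: "\<bar>(u t (L - h) - u t L + h * \<gamma>) / h\<^sup>2 - uxx t L / 2\<bar> \<le> (4 * M * L + R1) * h" .
  have "(4 * M * L + R1) * h \<ge> 0" "M * d \<ge> 0" using nonneg h d L_pos by auto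
  moreover have "\<bar>q / 2 - p\<bar> \<le> 3 / 2 * e + 2 * k"
    if "0 \<le> k" "0 \<le> e" "\<bar>p - w / 2\<bar> \<le> k" "\<bar>q - w\<bar> \<le> 3 / 2 * e" for p q w e k :: real
    using that by linarith
  moreover note space time_quotient[OF t d mem(1), unfolded mult.assoc]
  ultimately show "\<bar>((u (t + d) L - u t L) / d - f L) / 2 - (u t (L - h) - u t L + h * \<gamma>) / h\<^sup>2\<bar>
    \<le> 3 / 2 * M * d + 2 * (4 * M * L + R1) * h"
    unfolding mult.assoc by blast
qed (rule t)

end

subsection \<open>Stability of the scheme\<close>

text \<open>Being zero at \<open>0\<close> and at \<open>J\<close> builds in the no-flux ends: the
  matrix becomes a difference of consecutive fluxes at every node, the first and the last
  included.\<close>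

definition flux :: "nat \<Rightarrow> (nat \<Rightarrow> real) \<Rightarrow> nat \<Rightarrow> real" where
  "flux J v j = (if 0 < j \<and> j < J then v j - v (j - 1) else 0)"

definition avg :: "nat \<Rightarrow> (nat \<Rightarrow> real) \<Rightarrow> real" where
  "avg J v = (\<Sum>j<J. v j) / real J"

lemma Pmat_mult_eq_flux:
  assumes "J \<ge> 2" "j < J"
  shows "(\<Sum>k<J. Pmat J h j k * v k) = (flux J v (Suc j) - flux J v j) / h\<^sup>2"
proof -
  \<comment> \<open>The lower neighbour is selected by \<open>Suc k = j\<close>; with truncated
    subtraction \<open>k = j - 1\<close> would also hold for \<open>j = k = 0\<close>.\<close>
  have "(\<Sum>k<J. Pmat J h j k * v k)
    = (\<Sum>k<J. (if k = j then (if j = 0 \<or> j = J - 1 then - 1 else - 2) * v j / h\<^sup>2 else 0)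
        + (if k = Suc j then v (Suc j) / h\<^sup>2 else 0)
        + (if Suc k = j then v (j - 1) / h\<^sup>2 else 0))"
    by (intro sum.cong) (auto simp: Pmat_def)
  also have "\<dots> = (if j = 0 \<or> j = J - 1 then - 1 else - 2) * v j / h\<^sup>2
      + (if Suc j < J then v (Suc j) / h\<^sup>2 else 0) + (if 0 < j then v (j - 1) / h\<^sup>2 else 0)"
  proof -
    have "(\<Sum>k<J. (if Suc k = j then v (j - 1) / h\<^sup>2 else 0)) = (if 0 < j then v (j - 1) / h\<^sup>2 else 0)"
      using assms by (cases j) auto
    then show ?thesis using assms by (simp add: sum.distrib sum.delta)
  qed
  also have "\<dots> = (flux J v (Suc j) - flux J v j) / h\<^sup>2"
    using assms by (auto simp: flux_def add_divide_distrib diff_divide_distrib)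
  finally show ?thesis .
qed

lemma sum_flux_diff: "(\<Sum>j<J. flux J v (Suc j) - flux J v j) = 0"
  by (subst sum_lessThan_telescope) (simp add: flux_def)

lemma flux_diff: "flux J (\<lambda>i. v i - w i) j = flux J v j - flux J w j"
  by (simp add: flux_def)

lemma flux_add: "flux J (\<lambda>i. v i + w i) j = flux J v j + flux J w j"
  by (simp add: flux_def)

lemma flux_const: "flux J (\<lambda>i. v i - c) j = flux J v j"
  by (simp add: flux_def)

lemma flux_summation_by_parts:
  "(\<Sum>j<J. v j * (flux J v (Suc j) - flux J v j)) = - (\<Sum>j<J. (flux J v j)\<^sup>2)"
proof -
  \<comment> \<open>Partial sums carry the boundary term \<open>v (n - 1) * flux J v n\<close>,
    which vanishes at \<open>n = 0\<close> and at \<open>n = J\<close>.\<close>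
  have "(\<Sum>j<n. v j * (flux J v (Suc j) - flux J v j))
      = v (n - 1) * flux J v n - (\<Sum>j<n. (flux J v j)\<^sup>2)" if "n \<le> J" for n
    using that
  proof (induction n)
    case (Suc n)
    show ?case
    proof (cases n)
      case (Suc m)
      then have "flux J v n = v n - v (n - 1)" using Suc.prems by (simp add: flux_def)
      then have "v n = flux J v n + v (n - 1)" by simp
      then have "v n * flux J v n = (flux J v n)\<^sup>2 + v (n - 1) * flux J v n"
        by (metis distrib_right power2_eq_square)
      with Suc.IH Suc.prems show ?thesis
        by (simp add: algebra_simps power2_eq_square)
    qed (simp add: flux_def)
  qed (simp add: flux_def)
  from this[of J] show ?thesis by (simp add: flux_def)
qed

text \<open>Summation by parts and the parallelogram identity express the change of energy by the
  sum \<open>Q\<close> of squared fluxes and the sum \<open>S\<close> of squared sums of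
  neighbouring fluxes; \<open>lam\<^sup>2 \<le> lam / 2\<close> then cancels \<open>Q\<close>. At
  \<open>lam = 1 / 2\<close> vectors of alternating sign are hardly damped, so no fixed multiple of
  \<open>Q\<close> could be gained uniformly in \<open>J\<close>; \<open>S\<close> is small on
  precisely such vectors.\<close>

lemma explicit_step_energy:
  assumes "0 \<le> lam" "lam \<le> 1 / 2"
  shows "(\<Sum>j<J. (v j + lam * (flux J v (Suc j) - flux J v j))\<^sup>2)
    \<le> (\<Sum>j<J. (v j)\<^sup>2) - lam / 2 * (\<Sum>j<J. (flux J v (Suc j) + flux J v j)\<^sup>2)"
proof -
  define q where "q = flux J v"
  define Q where "Q = (\<Sum>j<J. (q j)\<^sup>2)"
  define S where "S = (\<Sum>j<J. (q (Suc j) + q j)\<^sup>2)"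
  have Q': "(\<Sum>j<J. (q (Suc j))\<^sup>2) = Q"
  proof -
    have "(\<Sum>j<J. (q (Suc j))\<^sup>2 - (q j)\<^sup>2) = 0"
      by (subst sum_lessThan_telescope) (simp add: q_def flux_def)
    then show ?thesis by (simp add: Q_def sum_subtractf)
  qed
  have D: "(\<Sum>j<J. (q (Suc j) - q j)\<^sup>2) = 4 * Q - S"
  proof -
    have "(\<Sum>j<J. (q (Suc j) - q j)\<^sup>2) = (\<Sum>j<J. 2 * (q (Suc j))\<^sup>2 + 2 * (q j)\<^sup>2 - (q (Suc j) + q j)\<^sup>2)"
      by (intro sum.cong) (auto simp: power2_eq_square algebra_simps)
    also have "\<dots> = 4 * Q - S"
      by (simp add: sum.distrib sum_subtractf sum_distrib_left[symmetric] Q' S_def Q_def[symmetric])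
    finally show ?thesis .
  qed
  have "(\<Sum>j<J. (v j + lam * (q (Suc j) - q j))\<^sup>2)
      = (\<Sum>j<J. (v j)\<^sup>2 + 2 * lam * (v j * (q (Suc j) - q j)) + lam\<^sup>2 * (q (Suc j) - q j)\<^sup>2)"
    by (intro sum.cong) (auto simp: power2_eq_square algebra_simps)
  also have "\<dots> = (\<Sum>j<J. (v j)\<^sup>2) - 2 * lam * Q + lam\<^sup>2 * (4 * Q - S)"
    using flux_summation_by_parts[of v J]
    by (simp add: sum.distrib sum_distrib_left[symmetric] D) (simp add: q_def Q_def)
  also have "\<dots> \<le> (\<Sum>j<J. (v j)\<^sup>2) - 2 * lam * Q + lam / 2 * (4 * Q - S)"
  proof -
    have "4 * Q - S \<ge> 0" unfolding D[symmetric] by (intro sum_nonneg) auto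
    moreover have "lam\<^sup>2 \<le> lam / 2"
      using mult_left_mono[OF assms(2,1)] by (simp add: power2_eq_square)
    ultimately show ?thesis by (intro add_left_mono mult_right_mono)
  qed
  also have "\<dots> = (\<Sum>j<J. (v j)\<^sup>2) - lam / 2 * S" by (simp add: algebra_simps)
  finally show ?thesis by (simp add: q_def S_def)
qed

text \<open>Since \<open>flux (j + 2) + flux (j + 1) = v (j + 2) - v j\<close>, this is the Poincare inequality for
  the graph that joins every node to its second neighbours, together with the edge \<open>0 - 1\<close>.\<close>
lemma discrete_poincare:
  assumes "(\<Sum>j<J. v j) = 0"
  shows "(\<Sum>j<J. (v j)\<^sup>2) \<le> (real J)\<^sup>2 * (\<Sum>j<J. (flux J v (Suc j) + flux J v j)\<^sup>2)"
proof -
  define a where "a = (\<lambda>j. \<bar>flux J v (Suc j) + flux J v j\<bar>)"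
  have path: "\<bar>v j - v 0\<bar> \<le> (\<Sum>i<j. a i)" if "j < J" for j
    using that
  proof (induction j rule: less_induct)
    case (less j)
    consider "j = 0" | "j = 1" | i where "j = Suc (Suc i)" by (metis One_nat_def not0_implies_Suc)
    then show ?case
    proof cases
      case 2
      then show ?thesis using less.prems by (simp add: a_def flux_def)
    next
      case (3 i)
      have "v j - v i = flux J v j + flux J v (Suc i)" using 3 less.prems by (simp add: flux_def)
      then have "\<bar>v j - v i\<bar> = a (Suc i)" using 3 by (simp add: a_def)
      moreover have "\<bar>v i - v 0\<bar> \<le> (\<Sum>i<i. a i)" using 3 less by simp
      moreover have "a i \<ge> 0" by (simp add: a_def)
      ultimately show ?thesis using 3 by simp
    qed simp
  qed
  have dev: "(v j - v 0)\<^sup>2 \<le> real J * (\<Sum>j<J. (a j)\<^sup>2)" if "j < J" for j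
  proof -
    have "\<bar>v j - v 0\<bar> \<le> (\<Sum>i<J. a i)"
      using path[OF that] by (rule order_trans) (use that in \<open>auto intro!: sum_mono2 simp: a_def\<close>)
    then have "(v j - v 0)\<^sup>2 \<le> (\<Sum>i<J. a i)\<^sup>2"
      by (metis abs_ge_zero power2_abs power_mono)
    also have "\<dots> \<le> (\<Sum>i<J. (a i)\<^sup>2) * (\<Sum>i<J. 1\<^sup>2)"
      using Cauchy_Schwarz_ineq_sum[of a "\<lambda>_. 1" "{..<J}"] by simp
    finally show ?thesis by (simp add: mult.commute)
  qed
  \<comment> \<open>For a mean-zero vector, deviations from any reference value have at least the
    same sum of squares, so node 0 may serve as reference. One factor \<open>real J\<close> is the
    Cauchy-Schwarz loss along a path, the other counts the nodes.\<close>
  have "(\<Sum>j<J. (v j)\<^sup>2) \<le> (\<Sum>j<J. (v j)\<^sup>2) + real J * (v 0)\<^sup>2" by simp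
  also have "\<dots> = (\<Sum>j<J. (v j - v 0)\<^sup>2)"
  proof -
    have "(\<Sum>j<J. (v j - v 0)\<^sup>2) = (\<Sum>j<J. (v j)\<^sup>2 + (v 0)\<^sup>2 - 2 * v 0 * v j)"
      by (intro sum.cong) (auto simp: power2_eq_square algebra_simps)
    then show ?thesis using assms by (simp add: sum.distrib sum_subtractf sum_distrib_left[symmetric])
  qed
  also have "\<dots> \<le> (\<Sum>j<J. real J * (\<Sum>j<J. (a j)\<^sup>2))" using dev by (intro sum_mono) auto
  finally show ?thesis by (simp add: a_def power2_eq_square mult.assoc)
qed

section \<open>The scaled norm and its splitting into mean and deviation\<close>

lemma l2norm_eq_L2_set: "l2norm J v = L2_set v {..<J} / sqrt (real J)"
  by (simp add: l2norm_def L2_set_def real_sqrt_divide)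

lemma l2norm_nonneg: "l2norm J v \<ge> 0"
  by (simp add: l2norm_def sum_nonneg)

lemma l2norm_cong: "(\<And>j. j < J \<Longrightarrow> v j = w j) \<Longrightarrow> l2norm J v = l2norm J w"
  by (simp add: l2norm_def)

lemma l2norm_triangle: "l2norm J (\<lambda>j. v j + w j) \<le> l2norm J v + l2norm J w"
  by (simp add: l2norm_eq_L2_set add_divide_distrib[symmetric] divide_right_mono L2_set_triangle_ineq)

lemma l2norm_triangle_sub: "l2norm J (\<lambda>j. v j - w j) \<le> l2norm J v + l2norm J w"
  using l2norm_triangle[of J v "\<lambda>j. - w j"] by (simp add: l2norm_def)

lemma l2norm_scale: "c \<ge> 0 \<Longrightarrow> l2norm J (\<lambda>j. c * v j) = c * l2norm J v"
  by (simp add: l2norm_eq_L2_set L2_set_right_distrib)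

lemma l2norm_le_sup:
  assumes "J > 0" "\<And>j. j < J \<Longrightarrow> \<bar>v j\<bar> \<le> C"
  shows "l2norm J v \<le> C"
proof -
  have C: "C \<ge> 0" using assms(2)[OF assms(1)] by linarith
  have "(\<Sum>j<J. (v j)\<^sup>2) \<le> (\<Sum>j<J. C\<^sup>2)"
    using assms(2) by (intro sum_mono) (metis abs_ge_zero lessThan_iff power2_abs power_mono)
  then have "1 / real J * (\<Sum>j<J. (v j)\<^sup>2) \<le> C\<^sup>2" using assms(1) by (simp add: field_simps)
  then show ?thesis unfolding l2norm_def using C by (simp add: real_le_lsqrt sum_nonneg)
qed

lemma l2norm_pythagoras:
  assumes "J > 0"
  shows "(l2norm J v)\<^sup>2 = (avg J v)\<^sup>2 + (l2norm J (\<lambda>j. v j - avg J v))\<^sup>2"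
proof -
  define m where "m = avg J v"
  have m: "(\<Sum>j<J. v j) = real J * m" using assms by (simp add: m_def avg_def)
  have "(\<Sum>j<J. (v j - m)\<^sup>2) = (\<Sum>j<J. (v j)\<^sup>2 + m\<^sup>2 - 2 * m * v j)"
    by (intro sum.cong) (auto simp: power2_eq_square algebra_simps)
  also have "\<dots> = (\<Sum>j<J. (v j)\<^sup>2) - real J * m\<^sup>2"
    by (simp add: sum.distrib sum_subtractf sum_distrib_left[symmetric] m power2_eq_square)
  finally show ?thesis using assms
    unfolding l2norm_def m_def[symmetric] by (simp add: sum_nonneg field_simps)
qed

lemma l2norm_minus_avg_le: "J > 0 \<Longrightarrow> l2norm J (\<lambda>j. v j - avg J v) \<le> l2norm J v"
  using l2norm_pythagoras[of J v] by (intro power2_le_imp_le[OF _ l2norm_nonneg]) auto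

text \<open>Adding the bounds for mean and deviation by the triangle inequality would cost a factor
  up to sqrt 2 on \<open>l2norm J v\<close>. Pythagoras together with the triangle inequality in the
  plane keeps that factor equal to 1.\<close>

lemma l2norm_le_of_parts:
  assumes "J > 0" "\<bar>avg J w - avg J v\<bar> \<le> a"
    and "l2norm J (\<lambda>j. w j - avg J w) \<le> l2norm J (\<lambda>j. v j - avg J v) + b" "b \<ge> 0"
  shows "l2norm J w \<le> l2norm J v + a + b"
proof -
  have norm: "l2norm J v = sqrt ((avg J v)\<^sup>2 + (l2norm J (\<lambda>j. v j - avg J v))\<^sup>2)" for v
    using l2norm_pythagoras[OF assms(1), of v] l2norm_nonneg[of J v] by (metis real_sqrt_unique)
  have a: "a \<ge> 0" using assms(2) by linarith
  have "l2norm J w \<le> sqrt ((\<bar>avg J v\<bar> + a)\<^sup>2 + (l2norm J (\<lambda>j. v j - avg J v) + b)\<^sup>2)"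
    unfolding norm[of w]
  proof (intro real_sqrt_le_mono add_mono)
    show "(avg J w)\<^sup>2 \<le> (\<bar>avg J v\<bar> + a)\<^sup>2"
      using assms(2) by (intro abs_le_square_iff[THEN iffD1]) auto
    show "(l2norm J (\<lambda>j. w j - avg J w))\<^sup>2 \<le> (l2norm J (\<lambda>j. v j - avg J v) + b)\<^sup>2"
      using assms(3) by (intro power_mono l2norm_nonneg)
  qed
  also have "\<dots> \<le> sqrt (\<bar>avg J v\<bar>\<^sup>2 + (l2norm J (\<lambda>j. v j - avg J v))\<^sup>2) + sqrt (a\<^sup>2 + b\<^sup>2)"
    by (rule real_sqrt_sum_squares_triangle_ineq)
  also have "sqrt (a\<^sup>2 + b\<^sup>2) \<le> a + b"
    using a assms(4) by (rule sqrt_sum_squares_le_sum)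
  finally show ?thesis by (simp add: norm[of v])
qed

lemma explicit_step_contraction:
  assumes "J > 0" "0 \<le> lam" "lam \<le> 1 / 2" "(\<Sum>j<J. v j) = 0"
  shows "l2norm J (\<lambda>j. v j + lam * (flux J v (Suc j) - flux J v j))
    \<le> (1 - lam / (4 * (real J)\<^sup>2)) * l2norm J v"
proof -
  \<comment> \<open>Energy estimate and Poincare inequality remove the fraction
    \<open>lam / (2 * (real J)\<^sup>2)\<close>, that is \<open>2 * c\<close>, of the energy, and
    \<open>1 - 2 * c \<le> (1 - c)\<^sup>2\<close>. As \<open>lam\<close> is the time step over the
    squared mesh size, \<open>c\<close> is comparable to the time step divided by the squared length
    of the interval.\<close>
  define c where "c = lam / (4 * (real J)\<^sup>2)"
  have "(real J)\<^sup>2 \<ge> 1" using assms(1) by simp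
  then have "lam \<le> 4 * (real J)\<^sup>2" using assms(3) by linarith
  then have c: "0 \<le> c" "c \<le> 1" using assms by (auto simp: c_def)
  have "(\<Sum>j<J. (v j + lam * (flux J v (Suc j) - flux J v j))\<^sup>2)
      \<le> (\<Sum>j<J. (v j)\<^sup>2) - lam / 2 * (\<Sum>j<J. (flux J v (Suc j) + flux J v j)\<^sup>2)"
    by (rule explicit_step_energy[OF assms(2,3)])
  also have "\<dots> \<le> (\<Sum>j<J. (v j)\<^sup>2) - 2 * c * (\<Sum>j<J. (v j)\<^sup>2)"
  proof -
    have "2 * c * (\<Sum>j<J. (v j)\<^sup>2) \<le> 2 * c * ((real J)\<^sup>2 * (\<Sum>j<J. (flux J v (Suc j) + flux J v j)\<^sup>2))"
      using c discrete_poincare[OF assms(4)] by (intro mult_left_mono) auto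
    also have "\<dots> = lam / 2 * (\<Sum>j<J. (flux J v (Suc j) + flux J v j)\<^sup>2)"
      using assms(1) by (simp add: c_def)
    finally show ?thesis by simp
  qed
  also have "\<dots> \<le> (1 - c)\<^sup>2 * (\<Sum>j<J. (v j)\<^sup>2)"
  proof -
    have "(1 - 2 * c) * (\<Sum>j<J. (v j)\<^sup>2) \<le> (1 - c)\<^sup>2 * (\<Sum>j<J. (v j)\<^sup>2)"
      by (intro mult_right_mono sum_nonneg) (auto simp: power2_eq_square algebra_simps)
    then show ?thesis by (simp add: algebra_simps)
  qed
  finally have "(\<Sum>j<J. (v j + lam * (flux J v (Suc j) - flux J v j))\<^sup>2) \<le> (\<Sum>j<J. ((1 - c) * v j)\<^sup>2)"
    by (simp add: power_mult_distrib sum_distrib_left)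
  then have "l2norm J (\<lambda>j. v j + lam * (flux J v (Suc j) - flux J v j)) \<le> l2norm J (\<lambda>j. (1 - c) * v j)"
    unfolding l2norm_def by (intro real_sqrt_le_mono mult_left_mono) auto
  then show ?thesis using c by (simp add: l2norm_scale c_def)
qed

text \<open>The part \<open>\<kappa> n\<close> of the defect is the same at all nodes and disappears
  on subtracting the mean, whatever its size; this absorbs \<open>r_dx\<close>. The other part is
  summed against powers of \<open>1 - c\<close>, hence the limit \<open>d / c * r\<close> of the
  geometric series.\<close>

lemma explicit_scheme_stability:
  fixes e \<rho> :: "nat \<Rightarrow> nat \<Rightarrow> real"
  assumes J: "J > 0" and lam: "0 < lam" "lam \<le> 1 / 2" and d: "d > 0"
    and step: "\<And>n j. j < J \<Longrightarrow>
      e (Suc n) j = e n j + lam * (flux J (e n) (Suc j) - flux J (e n) j) + d * (\<kappa> n + \<rho> n j)"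
    and \<rho>: "\<And>n j. j < J \<Longrightarrow> \<bar>\<rho> n j\<bar> \<le> r"
  shows "l2norm J (\<lambda>j. e n j - avg J (e n))
    \<le> l2norm J (\<lambda>j. e 0 j - avg J (e 0)) + 4 * d * (real J)\<^sup>2 / lam * r"
proof -
  define z where "z = (\<lambda>n j. e n j - avg J (e n))"
  define c where "c = lam / (4 * (real J)\<^sup>2)"
  have "(real J)\<^sup>2 \<ge> 1" using J by simp
  then have "lam \<le> 4 * (real J)\<^sup>2" using lam(2) by linarith
  then have c: "0 < c" "c \<le> 1" using lam J by (auto simp: c_def)
  have z0: "(\<Sum>j<J. z n j) = 0" for n using J by (simp add: z_def sum_subtractf avg_def)
  have zstep: "z (Suc n) j = (z n j + lam * (flux J (z n) (Suc j) - flux J (z n) j))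
      + d * (\<rho> n j - avg J (\<rho> n))" if "j < J" for n j
  proof -
    have "(\<Sum>j<J. e (Suc n) j) = (\<Sum>j<J. e n j + lam * (flux J (e n) (Suc j) - flux J (e n) j) + d * (\<kappa> n + \<rho> n j))"
      by (intro sum.cong) (use step in auto)
    also have "\<dots> = (\<Sum>j<J. e n j) + lam * (\<Sum>j<J. flux J (e n) (Suc j) - flux J (e n) j)
        + d * (real J * \<kappa> n + (\<Sum>j<J. \<rho> n j))"
      by (simp add: sum.distrib sum_distrib_left distrib_left)
    finally have "avg J (e (Suc n)) = avg J (e n) + d * (\<kappa> n + avg J (\<rho> n))"
      using J unfolding sum_flux_diff avg_def by (simp add: field_simps)
    moreover have "flux J (z n) = flux J (e n)" by (auto simp: z_def flux_const)
    ultimately show ?thesis using step[OF that, of n] by (simp add: z_def algebra_simps)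
  qed
  have r: "r \<ge> 0" using \<rho>[OF J, of 0] by linarith
  have "l2norm J (z n) \<le> l2norm J (z 0) + d / c * r"
  proof (induction n)
    case 0
    then show ?case using c d r by simp
  next
    case (Suc n)
    have "l2norm J (z (Suc n)) = l2norm J (\<lambda>j. (z n j + lam * (flux J (z n) (Suc j) - flux J (z n) j))
        + d * (\<rho> n j - avg J (\<rho> n)))"
      by (intro l2norm_cong zstep)
    also have "\<dots> \<le> l2norm J (\<lambda>j. z n j + lam * (flux J (z n) (Suc j) - flux J (z n) j))
        + l2norm J (\<lambda>j. d * (\<rho> n j - avg J (\<rho> n)))"
      by (rule l2norm_triangle)
    also have "\<dots> \<le> (1 - c) * l2norm J (z n) + d * r"
    proof (rule add_mono)
      show "l2norm J (\<lambda>j. z n j + lam * (flux J (z n) (Suc j) - flux J (z n) j)) \<le> (1 - c) * l2norm J (z n)"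
        unfolding c_def using J lam z0 by (intro explicit_step_contraction) auto
      have "l2norm J (\<lambda>j. \<rho> n j - avg J (\<rho> n)) \<le> r"
        using l2norm_minus_avg_le[OF J, of "\<rho> n"] l2norm_le_sup[OF J, of "\<rho> n" r] \<rho> by simp
      then show "l2norm J (\<lambda>j. d * (\<rho> n j - avg J (\<rho> n))) \<le> d * r"
        using d by (simp add: l2norm_scale)
    qed
    also have "\<dots> \<le> (1 - c) * (l2norm J (z 0) + d / c * r) + d * r"
      using Suc c by (intro add_right_mono mult_left_mono) auto
    also have "\<dots> = (1 - c) * l2norm J (z 0) + d / c * r" using c by (simp add: field_simps)
    also have "\<dots> \<le> 1 * l2norm J (z 0) + d / c * r"
      using c by (intro add_right_mono mult_right_mono l2norm_nonneg) auto
    finally show ?case by simp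
  qed
  then show ?thesis by (simp add: z_def c_def ac_simps)
qed

subsection \<open>Sobolev bounds\<close>

lemma Hk_derivs_0: "Hk_derivs L k u D \<Longrightarrow> x \<in> {0..L} \<Longrightarrow> D 0 x = u x"
  unfolding Hk_derivs_def by blast

lemma Hk_derivs_integrable:
  assumes "Hk_derivs L k u D" "i \<le> k"
  shows "D i absolutely_integrable_on {0..L}" "(\<lambda>x. (D i x)\<^sup>2) integrable_on {0..L}"
  using assms unfolding Hk_derivs_def by blast+

lemma Hk_derivs_FTC:
  assumes "Hk_derivs L k u D" "i < k" "x \<in> {0..L}"
  shows "D i 0 + integral {0..x} (D (Suc i)) = D i x"
proof -
  have "\<forall>i<k. \<forall>x\<in>{0..L}. D i x = D i 0 + integral {0..x} (D (Suc i))"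
    using assms(1) unfolding Hk_derivs_def by (elim conjE)
  then show ?thesis using assms(2,3) by (intro sym[of "D i x"]) blast
qed

lemma Hk_derivs_continuous:
  assumes "Hk_derivs L k u D" "i < k"
  shows "continuous_on {0..L} (D i)"
proof -
  have "D (Suc i) integrable_on {0..L}"
    using Hk_derivs_integrable(1)[OF assms(1), of "Suc i"] assms(2)
    by (simp add: absolutely_integrable_on_def)
  then have "continuous_on {0..L} (\<lambda>x. D i 0 + integral {0..x} (D (Suc i)))"
    by (intro continuous_intros indefinite_integral_continuous_1)
  then show ?thesis
    by (rule continuous_on_eq) (rule Hk_derivs_FTC[OF assms])
qed

text \<open>The integral identity differentiates pointwise where the integrand is continuous, which
  is known for orders below \<open>k\<close> but not for the top one.\<close>

lemma Hk_derivs_DERIV: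
  assumes "Hk_derivs L k u D" "Suc i < k" "x \<in> {0..L}"
  shows "(D i has_real_derivative D (Suc i) x) (at x within {0..L})"
proof -
  have "((\<lambda>x. D i 0 + integral {0..x} (D (Suc i))) has_real_derivative D (Suc i) x) (at x within {0..L})"
    using integral_has_real_derivative[OF Hk_derivs_continuous[OF assms(1,2)] assms(3)]
    by (auto intro!: derivative_eq_intros)
  then show ?thesis
    by (rule has_field_derivative_transform_within[OF _ zero_less_one assms(3)])
      (use assms in \<open>auto intro: Hk_derivs_FTC\<close>)
qed

lemma Hk_derivs_mono: "Hk_derivs L k u D \<Longrightarrow> j \<le> k \<Longrightarrow> Hk_derivs L j u D"
  unfolding Hk_derivs_def by (meson le_trans less_le_trans)

text \<open>\<open>H_norm\<close> picks its chain of derivatives by \<open>SOME\<close>. Agreement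
  below the top order transfers bounds on the chosen chain to the chain at hand.\<close>

lemma Hk_derivs_unique:
  assumes "L > 0" "Hk_derivs L k u D" "Hk_derivs L k u E" "i < k" "x \<in> {0..L}"
  shows "D i x = E i x"
  using assms(4,5)
proof (induction i arbitrary: x)
  case 0
  then show ?case using Hk_derivs_0[OF assms(2)] Hk_derivs_0[OF assms(3)] by simp
next
  case (Suc i)
  have "(E i has_real_derivative D (Suc i) x) (at x within {0..L})"
    by (rule has_field_derivative_transform_within
        [OF Hk_derivs_DERIV[OF assms(2) Suc.prems] zero_less_one Suc.prems(2)]) (use Suc in auto)
  then have D: "(E i has_vector_derivative D (Suc i) x) (at x within cbox 0 L)"
    by (simp add: has_real_derivative_iff_has_vector_derivative)
  have E: "(E i has_vector_derivative E (Suc i) x) (at x within cbox 0 L)"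
    using Hk_derivs_DERIV[OF assms(3) Suc.prems]
    by (simp add: has_real_derivative_iff_has_vector_derivative)
  show ?case
    using Suc.prems(2)
    by (intro vector_derivative_unique_within_closed_interval[OF \<open>L > 0\<close> _ D E]) simp
qed

lemma Ck_derivs_imp_Hk_derivs:
  assumes "Ck_derivs L k f F"
  shows "Hk_derivs L k f F"
proof -
  have F0: "\<forall>x\<in>{0..L}. F 0 x = f x" and cont: "\<And>i. i \<le> k \<Longrightarrow> continuous_on {0..L} (F i)"
    and deriv: "\<And>i x. i < k \<Longrightarrow> x \<in> {0..L} \<Longrightarrow> (F i has_real_derivative F (Suc i) x) (at x within {0..L})"
    using assms unfolding Ck_derivs_def by blast+
  have FTC: "F i x = F i 0 + integral {0..x} (F (Suc i))" if i: "i < k" and x: "x \<in> {0..L}" for i x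
  proof -
    have "(F (Suc i) has_integral F i x - F i 0) {0..x}"
    proof (rule fundamental_theorem_of_calculus)
      fix y assume y: "y \<in> {0..x}"
      then have "(F i has_real_derivative F (Suc i) y) (at y within {0..L})"
        using x by (intro deriv[OF i]) auto
      then have "(F i has_real_derivative F (Suc i) y) (at y within {0..x})"
        by (rule DERIV_subset) (use x in auto)
      then show "(F i has_vector_derivative F (Suc i) y) (at y within {0..x})"
        by (simp add: has_real_derivative_iff_has_vector_derivative)
    qed (use x in auto)
    then show ?thesis by (simp add: integral_unique)
  qed
  moreover have "F i absolutely_integrable_on {0..L}" "(\<lambda>x. (F i x)\<^sup>2) integrable_on {0..L}" if "i \<le> k" for i
    using absolutely_integrable_continuous_real[OF cont[OF that]]
    by (auto intro!: integrable_continuous_real continuous_intros cont[OF that])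
  ultimately show ?thesis using F0 unfolding Hk_derivs_def by blast
qed

text \<open>For \<open>K > 0\<close> the pointwise bound \<open>\<bar>g\<bar> \<le> (g\<^sup>2 / K + K) / 2\<close> stands in for Cauchy-Schwarz.\<close>
lemma integral_abs_le_of_integral_square_le:
  fixes g :: "real \<Rightarrow> real"
  assumes "L > 0" "K > 0" and g: "g absolutely_integrable_on {0..L}" "(\<lambda>x. (g x)\<^sup>2) integrable_on {0..L}"
    and le: "integral {0..L} (\<lambda>x. (g x)\<^sup>2) \<le> K\<^sup>2"
  shows "integral {0..L} (\<lambda>x. \<bar>g x\<bar>) \<le> (1 + L) / 2 * K"
proof -
  have i: "(\<lambda>x. (g x)\<^sup>2 * (1 / (2 * K))) integrable_on {0..L}"
    using g(2) by (rule integrable_on_mult_left)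
  have "integral {0..L} (\<lambda>x. \<bar>g x\<bar>) \<le> integral {0..L} (\<lambda>x. (g x)\<^sup>2 * (1 / (2 * K)) + K / 2)"
  proof (rule integral_le)
    show "(\<lambda>x. \<bar>g x\<bar>) integrable_on {0..L}"
      using g(1) by (simp add: absolutely_integrable_on_def)
    show "(\<lambda>x. (g x)\<^sup>2 * (1 / (2 * K)) + K / 2) integrable_on {0..L}"
      using i by (intro integrable_add) auto
    fix x
    have "0 \<le> (\<bar>g x\<bar> - K)\<^sup>2" by simp
    then show "\<bar>g x\<bar> \<le> (g x)\<^sup>2 * (1 / (2 * K)) + K / 2"
      using \<open>K > 0\<close> by (simp add: power2_eq_square field_simps)
  qed
  also have "\<dots> = integral {0..L} (\<lambda>x. (g x)\<^sup>2) * (1 / (2 * K)) + L * (K / 2)"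
    using \<open>L > 0\<close> by (subst integral_add[OF i]) auto
  also have "\<dots> \<le> K\<^sup>2 * (1 / (2 * K)) + L * (K / 2)"
    using le \<open>K > 0\<close> by (intro add_right_mono mult_right_mono) auto
  finally show ?thesis using \<open>K > 0\<close> by (simp add: power2_eq_square field_simps)
qed

text \<open>The one-dimensional Sobolev embedding: the value at \<open>x\<close> exceeds the value
  at \<open>y\<close> by at most the L1 norm of the next derivative taken twice, once for the path
  from 0 to each point; then average over \<open>y\<close>.\<close>

lemma Hk_derivs_sup_bound:
  assumes L: "L > 0" and D: "Hk_derivs L k u D" and i: "i < k" and x: "x \<in> {0..L}"
  shows "\<bar>D i x\<bar> \<le> (1 + L)\<^sup>2 / L * sqrt (\<Sum>i\<le>k. integral {0..L} (\<lambda>x. (D i x)\<^sup>2))"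
proof -
  define S where "S = (\<Sum>i\<le>k. integral {0..L} (\<lambda>x. (D i x)\<^sup>2))"
  have ai: "D j absolutely_integrable_on {0..L}" "(\<lambda>x. (D j x)\<^sup>2) integrable_on {0..L}" if "j \<le> k" for j
    using Hk_derivs_integrable[OF D that] .
  have pos: "integral {0..L} (\<lambda>x. (D j x)\<^sup>2) \<ge> 0" if "j \<le> k" for j
    using ai(2)[OF that] by (intro integral_nonneg) auto
  have S: "integral {0..L} (\<lambda>x. (D j x)\<^sup>2) \<le> S" if "j \<le> k" for j
    unfolding S_def using that pos by (intro member_le_sum) auto
  have S0: "S \<ge> 0" using S[of 0] pos[of 0] by simp
  have bound: "\<bar>D i x\<bar> \<le> (1 + L)\<^sup>2 / L * K" if K: "K > sqrt S" for K
  proof -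
    have K0: "K > 0" using K real_sqrt_ge_zero[OF S0] by linarith
    have SK: "S \<le> K\<^sup>2" using power_mono[of "sqrt S" K 2] K S0 by simp
    have I: "integral {0..L} (\<lambda>x. \<bar>D j x\<bar>) \<le> (1 + L) / 2 * K" if "j \<le> k" for j
      using integral_abs_le_of_integral_square_le[OF L K0 ai[OF that]] S[OF that] SK by simp
    have osc0: "\<bar>D i y - D i 0\<bar> \<le> (1 + L) / 2 * K" if y: "y \<in> {0..L}" for y
    proof -
      have abs: "D (Suc i) absolutely_integrable_on {0..L}" using ai i by simp
      have sub: "{0..y} \<subseteq> {0..L}" using y by auto
      have "D (Suc i) absolutely_integrable_on {0..y}"
        by (rule absolutely_integrable_on_subinterval[OF abs sub])
      then have "norm (integral {0..y} (D (Suc i))) \<le> integral {0..y} (\<lambda>x. norm (D (Suc i) x))"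
        by (intro integral_norm_bound_integral) (auto simp: absolutely_integrable_on_def)
      also have "\<dots> \<le> integral {0..L} (\<lambda>x. norm (D (Suc i) x))"
        using abs by (intro integral_subset_le sub integrable_on_subinterval[OF _ sub])
          (auto simp: absolutely_integrable_on_def)
      also have "\<dots> \<le> (1 + L) / 2 * K" using I[of "Suc i"] i by simp
      finally show ?thesis unfolding Hk_derivs_FTC[OF D i y, symmetric] by simp
    qed
    have "integral {0..L} (\<lambda>y. \<bar>D i x\<bar>) \<le> integral {0..L} (\<lambda>y. \<bar>D i y\<bar> + (1 + L) * K)"
    proof (rule integral_le)
      show "(\<lambda>y. \<bar>D i y\<bar> + (1 + L) * K) integrable_on {0..L}"
        using ai(1)[of i] i by (intro integrable_add) (auto simp: absolutely_integrable_on_def)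
      fix y assume "y \<in> {0..L}"
      then show "\<bar>D i x\<bar> \<le> \<bar>D i y\<bar> + (1 + L) * K" using osc0[of y] osc0[OF x] by argo
    qed auto
    also have "\<dots> = integral {0..L} (\<lambda>y. \<bar>D i y\<bar>) + L * ((1 + L) * K)"
      using ai(1)[of i] i L by (subst integral_add) (auto simp: absolutely_integrable_on_def)
    also have "\<dots> \<le> (1 + L) / 2 * K + L * ((1 + L) * K)" using I[of i] i by simp
    finally have "L * \<bar>D i x\<bar> \<le> (1 + L) / 2 * K + L * ((1 + L) * K)" using L by simp
    also have "\<dots> = (1 + L)\<^sup>2 * K - (1 + L) / 2 * K"
      by (simp add: power2_eq_square field_simps)
    also have "\<dots> \<le> (1 + L)\<^sup>2 * K" using L K0 by simp
    finally show ?thesis using L by (simp add: pos_le_divide_eq mult.commute)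
  qed
  \<comment> \<open>The L1 estimate divides by \<open>K\<close>, while \<open>sqrt S\<close> may be
    zero; it is approached from above.\<close>
  have "((\<lambda>K. (1 + L)\<^sup>2 / L * K) \<longlongrightarrow> (1 + L)\<^sup>2 / L * sqrt S) (at_right (sqrt S))"
    by (intro tendsto_intros)
  then have "\<bar>D i x\<bar> \<le> (1 + L)\<^sup>2 / L * sqrt S"
    by (rule tendsto_lowerbound)
      (use bound in \<open>auto intro: eventually_mono[OF eventually_at_right_less]\<close>)
  then show ?thesis by (simp add: S_def)
qed

lemma sup_le_H_norm:
  assumes "L > 0" "Hk_derivs L k u D" "i < k" "x \<in> {0..L}"
  shows "\<bar>D i x\<bar> \<le> (1 + L)\<^sup>2 / L * H_norm L k u"
proof -
  define E where "E = (SOME E. Hk_derivs L k u E)"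
  have E: "Hk_derivs L k u E" unfolding E_def by (rule someI[of _ D]) (rule assms(2))
  have "\<bar>E i x\<bar> \<le> (1 + L)\<^sup>2 / L * sqrt (\<Sum>i\<le>k. integral {0..L} (\<lambda>x. (E i x)\<^sup>2))"
    by (rule Hk_derivs_sup_bound[OF assms(1) E assms(3,4)])
  then show ?thesis
    using Hk_derivs_unique[OF assms(1,2) E assms(3,4)] by (simp add: H_norm_def Let_def E_def)
qed

subsection \<open>Error estimate\<close>

lemma grid_simps:
  assumes "J \<ge> 2"
  shows "grid L J 0 = 0" "grid L J (Suc j) = grid L J j + dx L J" "grid L J (J - 1) = L"
    "grid L J (J - 2) = L - dx L J"
proof -
  obtain k where "J = Suc (Suc k)" using assms by (metis add_2_eq_Suc le_Suc_ex)
  then show "grid L J (J - 1) = L" "grid L J (J - 2) = L - dx L J"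
    by (simp_all add: grid_def dx_def field_simps)
qed (simp_all add: grid_def distrib_right)

lemma grid_mem:
  assumes "L > 0" "j < J" "J \<ge> 2"
  shows "grid L J j \<in> {0..L}"
proof -
  have "real j * L \<le> (real J - 1) * L" using assms by (intro mult_right_mono) auto
  then show ?thesis using assms by (simp add: grid_def dx_def field_simps)
qed

lemma dx_bounds:
  assumes "L > 0" "J \<ge> 2"
  shows "dx L J > 0" "dx L J \<le> L" "real J * dx L J \<le> 2 * L" "L \<le> real J * dx L J"
  using assms by (auto simp: dx_def field_simps)

text \<open>There are \<open>J\<close> nodes but \<open>J - 1\<close> cells. The left-endpoint sum
  over the cells differs from the vanishing integral by at most \<open>K * h\<^sup>2\<close> per
  cell, \<open>K * h * L\<close> in all; the last node, with weight \<open>h\<close>, contributes as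
  much again.\<close>

lemma avg_grid_le_of_integral_zero:
  fixes g :: "real \<Rightarrow> real"
  assumes L: "L > 0" and J: "J \<ge> 2"
    and lip: "\<And>x y. x \<in> {0..L} \<Longrightarrow> y \<in> {0..L} \<Longrightarrow> \<bar>g x - g y\<bar> \<le> K * \<bar>x - y\<bar>"
    and int: "integral {0..L} g = 0"
  shows "\<bar>avg J (\<lambda>j. g (grid L J j))\<bar> \<le> 2 * K * dx L J"
proof -
  define h where "h = dx L J"
  define H where "H = (\<lambda>x. integral {0..x} g)"
  have h: "h > 0" "h \<le> L" "L \<le> real J * h" using dx_bounds[OF L J] by (simp_all add: h_def)
  have "0 \<le> K * L" using lip[of 0 L] L by (auto intro: order_trans[OF abs_ge_zero])
  then have K: "K \<ge> 0" using L by (simp add: zero_le_mult_iff)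
  have cont: "continuous_on {0..L} g"
    by (rule lipschitz_on_continuous_on[of K]) (use lip K in \<open>auto simp: lipschitz_on_def dist_real_def\<close>)
  have H: "(H has_real_derivative g x) (at x within {0..L})" if "x \<in> {0..L}" for x
    unfolding H_def by (rule integral_has_real_derivative[OF cont that])
  have H0: "H 0 = 0" "H L = 0" using int by (simp_all add: H_def)
  have cell: "\<bar>H y - H x - (y - x) * g x\<bar> \<le> K * h * (y - x)"
    if x: "x \<in> {0..L}" and y: "y \<in> {0..L}" and xy: "x \<le> y" "y \<le> x + h" for x y
  proof -
    have "norm ((H y - y * g x) - (H x - x * g x)) \<le> K * h * norm (y - x)"
    proof (rule field_differentiable_bound[where S = "{x..y}" and f' = "\<lambda>z. g z - g x"])
      fix z assume z: "z \<in> {x..y}"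
      have "(H has_real_derivative g z) (at z within {x..y})"
        by (rule DERIV_subset[OF H]) (use z x y in auto)
      then show "((\<lambda>z. H z - z * g x) has_real_derivative g z - g x) (at z within {x..y})"
        by (auto intro!: derivative_eq_intros)
      have "\<bar>g z - g x\<bar> \<le> K * \<bar>z - x\<bar>" using lip[of z x] z x y by auto
      also have "\<dots> \<le> K * h" using z xy K by (intro mult_left_mono) auto
      finally show "norm (g z - g x) \<le> K * h" by simp
    qed (use xy in auto)
    then show ?thesis using xy by (simp add: algebra_simps)
  qed
  obtain m where m: "J = Suc m" "m \<ge> 1" using J by (cases J) auto
  have mh: "real m * h = L" using m by (simp add: h_def dx_def)
  have "\<bar>h * (\<Sum>j<m. g (grid L J j))\<bar> = \<bar>\<Sum>j<m. (H (grid L J (Suc j)) - H (grid L J j)) - h * g (grid L J j)\<bar>"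
  proof -
    have "(\<Sum>j<m. H (grid L J (Suc j)) - H (grid L J j)) = H (grid L J m) - H (grid L J 0)"
      by (rule sum_lessThan_telescope)
    also have "\<dots> = 0" using grid_simps(1,3)[OF J, of L] m H0 by simp
    finally show ?thesis by (simp add: sum_subtractf sum_distrib_left)
  qed
  also have "\<dots> \<le> (\<Sum>j<m. K * h * h)"
  proof (rule sum_abs[THEN order_trans], rule sum_mono)
    fix j assume "j \<in> {..<m}"
    then have mem: "grid L J j \<in> {0..L}" "grid L J (Suc j) \<in> {0..L}"
      using grid_mem[OF L _ J] m by auto
    show "\<bar>(H (grid L J (Suc j)) - H (grid L J j)) - h * g (grid L J j)\<bar> \<le> K * h * h"
      using cell[OF mem] h grid_simps(2)[OF J, of L j] by (simp add: h_def)
  qed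
  also have "\<dots> = K * h * L" using mh by (simp add: algebra_simps)
  finally have sum: "\<bar>h * (\<Sum>j<m. g (grid L J j))\<bar> \<le> K * h * L" .
  \<comment> \<open>For the last node: a function of integral zero cannot exceed its oscillation,
    which is at most \<open>K * L\<close>.\<close>
  have sup: "\<bar>g x\<bar> \<le> K * L" if x: "x \<in> {0..L}" for x
  proof -
    have "\<bar>H L - H 0 - L * g x\<bar> \<le> K * L * L"
    proof -
      have "norm ((H L - L * g x) - (H 0 - 0 * g x)) \<le> K * L * norm (L - 0)"
      proof (rule field_differentiable_bound[where S = "{0..L}" and f' = "\<lambda>z. g z - g x"])
        fix z assume z: "z \<in> {0..L}"
        show "((\<lambda>z. H z - z * g x) has_real_derivative g z - g x) (at z within {0..L})"
          using H[OF z] by (auto intro!: derivative_eq_intros)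
        have "\<bar>g z - g x\<bar> \<le> K * \<bar>z - x\<bar>" using lip[of z x] z x by auto
        also have "\<dots> \<le> K * L" using z x K by (intro mult_left_mono) auto
        finally show "norm (g z - g x) \<le> K * L" by simp
      qed (use L in auto)
      then show ?thesis using L by simp
    qed
    then have "L * \<bar>g x\<bar> \<le> L * (K * L)" using L by (simp add: H0 abs_mult ac_simps)
    then show ?thesis using L by simp
  qed
  have gm: "\<bar>h * g (grid L J m)\<bar> \<le> K * h * L"
    using sup[OF grid_mem[OF L _ J, of m]] m h by (simp add: abs_mult ac_simps)
  have split: "h * (\<Sum>j<J. g (grid L J j)) = h * (\<Sum>j<m. g (grid L J j)) + h * g (grid L J m)"
    by (simp add: m algebra_simps)
  have "\<bar>h * (\<Sum>j<J. g (grid L J j))\<bar> \<le> 2 * (K * h * L)"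
    unfolding split using sum gm by linarith
  also have "\<dots> \<le> 2 * (K * h * (real J * h))"
    using h K by (intro mult_left_mono) auto
  finally have "h * \<bar>\<Sum>j<J. g (grid L J j)\<bar> \<le> h * (2 * K * h * real J)"
    using h by (simp add: abs_mult ac_simps)
  then have "\<bar>\<Sum>j<J. g (grid L J j)\<bar> \<le> 2 * K * h * real J" using h by simp
  then show ?thesis using J by (simp add: avg_def h_def field_simps)
qed

text \<open>This is the purpose of \<open>r_dx\<close>: it offsets the quadrature error of
  \<open>f\<close>, so that the discrete source balances the boundary fluxes exactly and the scheme
  conserves its mean.\<close>

lemma sum_b_dx:
  assumes "L > 0" "J \<ge> 2" "\<gamma> - \<beta> + integral {0..L} f = 0"
  shows "(\<Sum>j<J. b_dx L J f \<beta> \<gamma> j) = 0"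
proof -
  define h where "h = dx L J"
  have h: "h > 0" using dx_bounds[OF assms(1,2)] by (simp add: h_def)
  have "(\<Sum>j<J. b_dx L J f \<beta> \<gamma> j) = (\<Sum>j<J. f (grid L J j)) - \<beta> / h + \<gamma> / h + real J * r_dx L J f"
    using assms(2) by (simp add: b_dx_def sum.distrib sum.delta h_def)
  also have "real J * r_dx L J f = (integral {0..L} f) / h - (\<Sum>j<J. f (grid L J j))"
    using assms(2) h by (simp add: r_dx_def h_def field_simps)
  finally have "(\<Sum>j<J. b_dx L J f \<beta> \<gamma> j) = (\<gamma> - \<beta> + integral {0..L} f) / h"
    by (simp add: add_divide_distrib diff_divide_distrib)
  then show ?thesis using assms(3) by simp
qed

text \<open>The truncation error of the scheme is \<open>a / 2\<close> and \<open>c / 2\<close>, up to first order terms, at the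
  two boundary nodes; \<open>corrector\<close> samples \<open>h / 2\<close> times the quadratic with slopes \<open>a\<close>, \<open>- c\<close> at
  the ends, which the discrete Laplacian maps to these values up to first order terms.\<close>
definition corrector :: "real \<Rightarrow> nat \<Rightarrow> real \<Rightarrow> real \<Rightarrow> nat \<Rightarrow> real" where
  "corrector L J a c j = dx L J / 2 *
     (a * (grid L J j - (grid L J j)\<^sup>2 / (2 * L)) - c * ((grid L J j)\<^sup>2 / (2 * L)))"

lemma corrector_diff:
  "corrector L J (a - a') (c - c') j = corrector L J a c j - corrector L J a' c' j"
proof -
  have "h * ((a - a') * p - (c - c') * q) = h * (a * p - c * q) - h * (a' * p - c' * q)" for h p q :: real
    by (simp add: algebra_simps)
  then show ?thesis by (simp only: corrector_def)
qed

lemma corrector_bound: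
  assumes "L > 0" "J \<ge> 2" "j < J" "\<bar>a\<bar> \<le> k" "\<bar>c\<bar> \<le> k"
  shows "\<bar>corrector L J a c j\<bar> \<le> dx L J / 2 * (k * L)"
proof -
  define x where "x = grid L J j"
  define q where "q = x\<^sup>2 / (2 * L)"
  have x: "0 \<le> x" "x \<le> L" using grid_mem[OF assms(1,3,2)] by (auto simp: x_def)
  \<comment> \<open>This is the bound \<open>L / 2\<close> for
    \<open>x - x\<^sup>2 / (2 * L)\<close>.\<close>
  have "0 \<le> (L - x)\<^sup>2" by simp
  then have q: "\<bar>q\<bar> \<le> L / 2" "\<bar>x - q\<bar> \<le> L / 2"
    using x assms(1) mult_mono[of x L x L] mult_right_mono[of x "2 * L" x]
    by (auto simp: q_def abs_le_iff field_simps power2_eq_square)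
  have "k \<ge> 0" using assms(4) by linarith
  then have "\<bar>a * (x - q)\<bar> \<le> k * (L / 2)" "\<bar>c * q\<bar> \<le> k * (L / 2)"
    unfolding abs_mult using mult_mono[OF assms(4) q(2)] mult_mono[OF assms(5) q(1)] by simp_all
  then have "\<bar>a * (x - q) - c * q\<bar> \<le> k * L" by linarith
  then show ?thesis
    using dx_bounds(1)[OF assms(1,2)] by (simp add: corrector_def x_def q_def abs_mult)
qed

text \<open>Second differences of a quadratic are exact. Differences of fluxes sum to zero, so the
  end values \<open>a / 2\<close> and \<open>c / 2\<close> must come with a compensation: spread
  over the grid with weight 1/2 at the ends, \<open>(a + c) * h / (2 * L)\<close> is taken
  \<open>J - 1\<close> times and totals \<open>(a + c) / 2\<close>.\<close>

lemma corrector_flux: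
  assumes "L > 0" "J \<ge> 2" "j < J"
  shows "(flux J (corrector L J a c) (Suc j) - flux J (corrector L J a c) j) / (dx L J)\<^sup>2
    = (if j = 0 then a / 2 else if j = J - 1 then c / 2 else 0)
      - (a + c) * dx L J / (2 * L) * (if j = 0 \<or> j = J - 1 then 1 / 2 else 1)"
proof -
  define h where "h = dx L J"
  define k where "k = 1 / (2 * L)"
  define p where "p = (\<lambda>x. h / 2 * (a * (x - x\<^sup>2 * k) - c * (x\<^sup>2 * k)))"
  have h: "h > 0" using dx_bounds(1)[OF assms(1,2)] by (simp add: h_def)
  have w: "(a + c) * h / (2 * L) = (a + c) * h * k" by (simp add: k_def)
  have p: "corrector L J a c i = p (grid L J i)" for i by (simp add: p_def corrector_def h_def k_def)
  consider "j = 0" | "j = J - 1" "j \<noteq> 0" | "0 < j" "Suc j < J" using assms(3) by linarith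
  then show ?thesis
  proof cases
    case 1
    have "flux J (corrector L J a c) (Suc j) - flux J (corrector L J a c) j = p h - p 0"
      using 1 assms(2) grid_simps[OF assms(2), of L] by (simp add: flux_def p h_def)
    also have "\<dots> = h\<^sup>2 * (a / 2 - (a + c) * h * k * (1 / 2))"
      by (simp add: p_def power2_eq_square field_simps)
    finally have fl: "(flux J (corrector L J a c) (Suc j) - flux J (corrector L J a c) j) / h\<^sup>2
      = (a / 2 - (a + c) * h * k * (1 / 2))" using h by simp
    show ?thesis
      unfolding h_def[symmetric] fl w using 1 assms(2) by simp
  next
    case 2
    have "flux J (corrector L J a c) (Suc j) - flux J (corrector L J a c) j = p (L - h) - p L"
      using 2 assms(2) grid_simps[OF assms(2), of L]
      by (simp add: flux_def p h_def numeral_2_eq_2)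
    also have "\<dots> = h\<^sup>2 * (c / 2 - (a + c) * h * k * (1 / 2)) + h\<^sup>2 / 2 * (a + c) * (2 * L * k - 1)"
      by (simp add: p_def power2_eq_square field_simps)
    also have "2 * L * k - 1 = 0" using assms(1) by (simp add: k_def)
    finally have fl: "(flux J (corrector L J a c) (Suc j) - flux J (corrector L J a c) j) / h\<^sup>2
      = (c / 2 - (a + c) * h * k * (1 / 2))" using h by simp
    show ?thesis
      unfolding h_def[symmetric] fl w using 2 assms(2) by simp
  next
    case 3
    define x where "x = grid L J j"
    obtain i where i: "j = Suc i" using 3 by (cases j) auto
    have "flux J (corrector L J a c) (Suc j) - flux J (corrector L J a c) j = p (x + h) - p x - (p x - p (x - h))"
      using 3 grid_simps(2)[OF assms(2), of L] i by (simp add: flux_def p h_def x_def)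
    also have "\<dots> = h\<^sup>2 * (- ((a + c) * h * k))"
      by (simp add: p_def power2_eq_square field_simps)
    finally have fl: "(flux J (corrector L J a c) (Suc j) - flux J (corrector L J a c) j) / h\<^sup>2
      = (- ((a + c) * h * k))" using h by simp
    show ?thesis
      unfolding h_def[symmetric] fl w using 3 by auto
  qed
qed

context neumann_heat_regular
begin

lemma scheme_error:
  assumes mass: "\<gamma> - \<beta> + integral {0..L} f = 0"
    and J: "J \<ge> 2" and d: "0 < d" "d / (dx L J)\<^sup>2 \<le> 1 / 2"
    and scheme: "\<And>n j. j < J \<Longrightarrow> v (Suc n) j = v n j + d * (\<Sum>k<J. Pmat J (dx L J) j k * v n k)
        + d * b_dx L J f \<beta> \<gamma> j"
  shows "l2norm J (\<lambda>j. u (real n * d) (grid L J j) - v n j) \<le> l2norm J (\<lambda>j. u 0 (grid L J j) - v 0 j)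
    + 4 * N * L * dx L J + dx L J * ((N + R) * L)
    + 16 * L\<^sup>2 * (3 / 2 * M * d + 2 * (4 * M * L + R1) * dx L J + (N + R) * dx L J / L + 2 * M * L * dx L J)"
proof -
  define h where "h = dx L J"
  define lam where "lam = d / h\<^sup>2"
  define X where "X = grid L J"
  define T where "T = (\<lambda>n. real n * d)"
  define W where "W = (\<lambda>n j. u (T n) (X j))"
  define D where "D = (\<lambda>n x. (u (T n + d) x - u (T n) x) / d)"
  \<comment> \<open>\<open>a\<close> and \<open>c\<close> stand for \<open>uxx\<close> at the two
    ends, but through time quotients: these exist at time 0 too, and their increments are mixed
    differences.\<close>
  define a where "a = (\<lambda>n. D n 0 - f 0)"
  define c where "c = (\<lambda>n. D n L - f L)"
  define \<psi> where "\<psi> = (\<lambda>n. corrector L J (a n) (c n))"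
  define bd where "bd = (\<lambda>j. (if j = 0 then - \<beta> / h else 0) + (if j = J - 1 then \<gamma> / h else 0))"
  define e where "e = (\<lambda>n j. W n j + \<psi> n j - v n j)"
  \<comment> \<open>The residual that makes \<open>e\<close> satisfy the scheme with source
    \<open>- r_dx L J f + \<rho> n j\<close>. It includes the time increment of the corrector,
    divided by \<open>d\<close>.\<close>
  define \<rho> where "\<rho> = (\<lambda>n j. D n (X j) - f (X j) - bd j
      - (flux J (W n) (Suc j) - flux J (W n) j) / h\<^sup>2
      - (flux J (\<psi> n) (Suc j) - flux J (\<psi> n) j) / h\<^sup>2 + (\<psi> (Suc n) j - \<psi> n j) / d)"
  define E where "E = 3 / 2 * M * d + 2 * (4 * M * L + R1) * h"
  define r where "r = E + (N + R) * h / L + 2 * M * L * h"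
  have h: "0 < h" "h \<le> L" using dx_bounds[OF L_pos J] by (auto simp: h_def)
  have lam: "0 < lam" "lam \<le> 1 / 2" using d h by (auto simp: lam_def h_def)
  have J0: "J > 0" using J by simp
  have T: "T n \<ge> 0" "T (Suc n) = T n + d" for n using d by (auto simp: T_def algebra_simps)
  have X: "X j \<in> {0..L}" if "j < J" for j using grid_mem[OF L_pos that J] by (simp add: X_def)
  have X_simps: "X 0 = 0" "X (Suc j) = X j + h" "X (J - 1) = L" "X (J - 2) = L - h" for j
    using grid_simps[OF J, of L] by (auto simp: X_def h_def)
  have D_bound: "\<bar>D n x - f x\<bar> \<le> N + R" if "x \<in> {0..L}" for n x
  proof -
    have "\<bar>D n x\<bar> \<le> N * d / d"
      unfolding D_def abs_divide abs_of_pos[OF d(1)] using u_time_lipschitz[OF T(1), of d x n] d that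
      by (intro divide_right_mono) auto
    then show ?thesis using R[OF that] d by simp
  qed
  have ac: "\<bar>a n\<bar> \<le> N + R" "\<bar>c n\<bar> \<le> N + R" for n
    using D_bound L_pos by (auto simp: a_def c_def)
  \<comment> \<open>Both steps of the mixed difference equal \<open>d\<close>. Without this factor
    \<open>d\<close>, the increment of the corrector divided by \<open>d\<close> would not be of
    order \<open>h\<close>.\<close>
  have D_step: "\<bar>D (Suc n) x - D n x\<bar> \<le> 4 * M * d" if "x \<in> {0..L}" for n x
  proof -
    have "D (Suc n) x - D n x = ((u (T n + d + d) x - u (T n + d) x) - (u (T n + d) x - u (T n) x)) / d"
      unfolding D_def T(2) by (rule diff_divide_distrib[symmetric])
    also have "\<bar>\<dots>\<bar> \<le> 4 * M * d * d / d"
      unfolding abs_divide abs_of_pos[OF d(1)]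
      using mixed_difference_bound[OF T(1), of d d x n] d that by (intro divide_right_mono) auto
    finally show ?thesis using d by simp
  qed
  have \<psi>_bound: "\<bar>\<psi> n j\<bar> \<le> h / 2 * ((N + R) * L)" if "j < J" for n j
    unfolding \<psi>_def h_def by (rule corrector_bound[OF L_pos J that ac])
  have \<psi>_step: "\<bar>(\<psi> (Suc n) j - \<psi> n j) / d\<bar> \<le> 2 * M * L * h" if "j < J" for n j
  proof -
    have "\<psi> (Suc n) j - \<psi> n j = corrector L J (a (Suc n) - a n) (c (Suc n) - c n) j"
      by (simp only: \<psi>_def corrector_diff)
    also have "\<bar>\<dots>\<bar> \<le> h / 2 * (4 * M * d * L)"
      unfolding h_def using D_step L_pos
      by (intro corrector_bound[OF L_pos J that]) (auto simp: a_def c_def)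
    finally have "\<bar>\<psi> (Suc n) j - \<psi> n j\<bar> / d \<le> h / 2 * (4 * M * d * L) / d"
      using d by (intro divide_right_mono) auto
    then show ?thesis using d by (simp add: abs_divide ac_simps)
  qed
  have \<rho>_bound: "\<bar>\<rho> n j\<bar> \<le> r" if j: "j < J" for n j
  proof -
    define w where "w = (a n + c n) * h / (2 * L)"
    have "\<bar>a n + c n\<bar> \<le> 2 * (N + R)" using order_trans[OF abs_triangle_ineq add_mono[OF ac]] unfolding mult_2 .
    then have "\<bar>a n + c n\<bar> * h / (2 * L) \<le> 2 * (N + R) * h / (2 * L)"
      using h L_pos by (intro divide_right_mono mult_right_mono) auto
    moreover have "\<bar>w\<bar> = \<bar>a n + c n\<bar> * h / (2 * L)"
      using h L_pos by (simp add: w_def abs_mult abs_divide)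
    moreover have "2 * (N + R) * h / (2 * L) = (N + R) * h / L"
      using L_pos by (simp add: field_simps)
    ultimately have w: "\<bar>w\<bar> \<le> (N + R) * h / L" by linarith
    have flux\<psi>: "(flux J (\<psi> n) (Suc j) - flux J (\<psi> n) j) / h\<^sup>2
      = (if j = 0 then a n / 2 else if j = J - 1 then c n / 2 else 0)
        - w * (if j = 0 \<or> j = J - 1 then 1 / 2 else 1)"
      unfolding \<psi>_def h_def w_def by (rule corrector_flux[OF L_pos J j])
    consider "j = 0" | "j = J - 1" "j \<noteq> 0" | "0 < j" "Suc j < J" using j by linarith
    then have "\<bar>D n (X j) - f (X j) - bd j - (flux J (W n) (Suc j) - flux J (W n) j) / h\<^sup>2
        - (if j = 0 then a n / 2 else if j = J - 1 then c n / 2 else 0)\<bar> \<le> E"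
    proof cases
      case 1
      have fl: "flux J (W n) (Suc j) - flux J (W n) j = u (T n) h - u (T n) 0"
        using 1 J X_simps(1,2) by (simp add: flux_def W_def)
      have bd: "bd j = - \<beta> / h" using 1 J by (simp add: bd_def)
      have w: "D n (X j) - f (X j) = a n" "(if j = 0 then a n / 2 else if j = J - 1 then c n / 2 else 0) = a n / 2"
        using 1 X_simps(1) by (simp_all add: a_def)
      have "\<bar>a n / 2 - (u (T n) h - u (T n) 0 - h * \<beta>) / h\<^sup>2\<bar> \<le> E"
        using consistency_left[OF T(1) d(1) h, of n] by (simp add: a_def D_def E_def)
      moreover have "(u (T n) h - u (T n) 0 - h * \<beta>) / h\<^sup>2 = (u (T n) h - u (T n) 0) / h\<^sup>2 + - \<beta> / h"
        using h by (simp add: diff_divide_distrib power2_eq_square)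
      ultimately show ?thesis unfolding fl bd w by linarith
    next
      case 2
      have fl: "flux J (W n) (Suc j) - flux J (W n) j = u (T n) (L - h) - u (T n) L"
        using 2 J X_simps(3,4) by (simp add: flux_def W_def numeral_2_eq_2)
      have bd: "bd j = \<gamma> / h" using 2 J by (simp add: bd_def)
      have w: "D n (X j) - f (X j) = c n" "(if j = 0 then a n / 2 else if j = J - 1 then c n / 2 else 0) = c n / 2"
        using 2 X_simps(3) by (simp_all add: c_def)
      have "\<bar>c n / 2 - (u (T n) (L - h) - u (T n) L + h * \<gamma>) / h\<^sup>2\<bar> \<le> E"
        using consistency_right[OF T(1) d(1) h, of n] by (simp add: c_def D_def E_def)
      moreover have "(u (T n) (L - h) - u (T n) L + h * \<gamma>) / h\<^sup>2 = (u (T n) (L - h) - u (T n) L) / h\<^sup>2 + \<gamma> / h"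
        using h by (simp add: add_divide_distrib power2_eq_square)
      ultimately show ?thesis unfolding fl bd w by linarith
    next
      case 3
      obtain i where i: "j = Suc i" using 3 by (cases j) auto
      have fl: "flux J (W n) (Suc j) - flux J (W n) j
          = u (T n) (X j + h) - 2 * u (T n) (X j) + u (T n) (X j - h)"
        using 3 X_simps(2) i by (simp add: flux_def W_def)
      have bd: "bd j = 0" using 3 by (simp add: bd_def)
      have w: "(if j = 0 then a n / 2 else if j = J - 1 then c n / 2 else 0) = 0"
        using 3 by auto
      have "X j - h \<ge> 0" "X j + h \<le> L"
        using X[of i] X[of "Suc j"] X_simps(2) 3 i by auto
      then show ?thesis
        unfolding fl bd w using consistency_interior[OF T(1) d(1) h(1), of "X j" n]
        by (simp add: D_def E_def)
    qed
    moreover have "\<bar>w * (1 / 2)\<bar> \<le> (N + R) * h / L" using w by linarith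
    then have "\<bar>w * (if j = 0 \<or> j = J - 1 then 1 / 2 else 1)\<bar> \<le> (N + R) * h / L"
      using w by (cases "j = 0 \<or> j = J - 1") simp_all
    ultimately show ?thesis
      unfolding \<rho>_def flux\<psi> r_def using \<psi>_step[OF j, of n] by linarith
  qed
  have vstep: "v (Suc n) j = v n j + lam * (flux J (v n) (Suc j) - flux J (v n) j) + d * b_dx L J f \<beta> \<gamma> j"
    if "j < J" for n j
    using scheme[OF that, of n] unfolding Pmat_mult_eq_flux[OF J that] by (simp add: lam_def h_def)
  have estep: "e (Suc n) j = e n j + lam * (flux J (e n) (Suc j) - flux J (e n) j) + d * (- r_dx L J f + \<rho> n j)"
    if j: "j < J" for n j
  proof -
    have b: "b_dx L J f \<beta> \<gamma> j = f (X j) + bd j + r_dx L J f" by (simp add: b_dx_def bd_def X_def h_def)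
    have flux_e: "flux J (e n) i = flux J (W n) i + flux J (\<psi> n) i - flux J (v n) i" for i
      unfolding e_def by (simp add: flux_diff flux_add)
    have "d * \<rho> n j = d * D n (X j) - d * f (X j) - d * bd j
        - lam * (flux J (W n) (Suc j) - flux J (W n) j)
        - lam * (flux J (\<psi> n) (Suc j) - flux J (\<psi> n) j) + (\<psi> (Suc n) j - \<psi> n j)"
    proof -
      have "d * (x - y - z - p / h\<^sup>2 - q / h\<^sup>2 + w / d) = d * x - d * y - d * z - lam * p - lam * q + w"
        for x y z p q w :: real
        using d(1) by (simp add: lam_def right_diff_distrib distrib_left)
      then show ?thesis unfolding \<rho>_def .
    qed
    moreover have "d * D n (X j) = W (Suc n) j - W n j"
      using d(1) by (simp add: D_def W_def T(2))
    ultimately show ?thesis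
      using vstep[OF j, of n] unfolding flux_e b by (simp add: e_def algebra_simps)
  qed
  define Er where "Er = (\<lambda>n j. W n j - v n j)"
  have stab: "l2norm J (\<lambda>j. e n j - avg J (e n)) \<le> l2norm J (\<lambda>j. e 0 j - avg J (e 0)) + 16 * L\<^sup>2 * r"
  proof -
    \<comment> \<open>Since \<open>d / lam = h\<^sup>2\<close>, the stability constant is
      \<open>4 * (real J * h)\<^sup>2\<close>, and \<open>real J * h \<le> 2 * L\<close>.\<close>
    have "4 * d * (real J)\<^sup>2 / lam * r \<le> 16 * L\<^sup>2 * r"
    proof (rule mult_right_mono)
      have "(real J * h)\<^sup>2 \<le> 4 * L\<^sup>2"
        using power_mono[of "real J * h" "2 * L" 2] dx_bounds(3)[OF L_pos J] h
        by (simp add: h_def power_mult_distrib)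
      moreover have "4 * d * (real J)\<^sup>2 / lam = 4 * (real J * h)\<^sup>2"
        using d h by (simp add: lam_def power_mult_distrib)
      ultimately show "4 * d * (real J)\<^sup>2 / lam \<le> 16 * L\<^sup>2" by linarith
      show "0 \<le> r" using \<rho>_bound[OF J0, of 0] by linarith
    qed
    then show ?thesis
      using explicit_scheme_stability[where e = e and \<rho> = \<rho> and \<kappa> = "\<lambda>_. - r_dx L J f",
          OF J0 lam d(1) estep \<rho>_bound, of n] by linarith
  qed
  \<comment> \<open>The corrector is paid for twice, on entering at time 0 and on leaving at step
    \<open>n\<close>.\<close>
  have split: "l2norm J (\<lambda>j. e n j - avg J (e n)) \<le> l2norm J (\<lambda>j. Er n j - avg J (Er n)) + h / 2 * ((N + R) * L)"
    "l2norm J (\<lambda>j. Er n j - avg J (Er n)) \<le> l2norm J (\<lambda>j. e n j - avg J (e n)) + h / 2 * ((N + R) * L)" for n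
  proof -
    have avg_e: "avg J (e n) = avg J (Er n) + avg J (\<psi> n)"
      by (simp add: avg_def e_def Er_def sum.distrib sum_subtractf add_divide_distrib diff_divide_distrib)
    have \<psi>: "l2norm J (\<lambda>j. \<psi> n j - avg J (\<psi> n)) \<le> h / 2 * ((N + R) * L)"
      by (rule order_trans[OF l2norm_minus_avg_le[OF J0] l2norm_le_sup[OF J0 \<psi>_bound]])
    have e: "(\<lambda>j. e n j - avg J (e n)) = (\<lambda>j. (Er n j - avg J (Er n)) + (\<psi> n j - avg J (\<psi> n)))"
      unfolding avg_e by (simp add: e_def Er_def algebra_simps)
    have Er: "(\<lambda>j. Er n j - avg J (Er n)) = (\<lambda>j. (e n j - avg J (e n)) - (\<psi> n j - avg J (\<psi> n)))"
      unfolding avg_e by (simp add: e_def Er_def algebra_simps)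
    show "l2norm J (\<lambda>j. e n j - avg J (e n)) \<le> l2norm J (\<lambda>j. Er n j - avg J (Er n)) + h / 2 * ((N + R) * L)"
      unfolding e using l2norm_triangle \<psi> by (rule order_trans[OF _ add_left_mono])
    show "l2norm J (\<lambda>j. Er n j - avg J (Er n)) \<le> l2norm J (\<lambda>j. e n j - avg J (e n)) + h / 2 * ((N + R) * L)"
      unfolding Er using l2norm_triangle_sub \<psi> by (rule order_trans[OF _ add_left_mono])
  qed
  \<comment> \<open>With the discrete mean constant, the mean of the error changes only by that of
    \<open>u (T n) - u 0\<close>, whose integral vanishes by conservation of mass. Time 0 is apart
    because the Lipschitz bound is for positive times.\<close>
  have mean: "\<bar>avg J (Er n) - avg J (Er 0)\<bar> \<le> 4 * N * L * h"
  proof (cases "n = 0")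
    case True
    then show ?thesis using nonneg h L_pos by simp
  next
    case False
    then have Tn: "T n > 0" using d by (simp add: T_def)
    have "avg J (v m) = avg J (v 0)" for m
    proof (induction m)
      case (Suc m)
      have "(\<Sum>j<J. v (Suc m) j)
          = (\<Sum>j<J. v m j + lam * (flux J (v m) (Suc j) - flux J (v m) j) + d * b_dx L J f \<beta> \<gamma> j)"
        by (intro sum.cong) (use vstep in auto)
      also have "\<dots> = (\<Sum>j<J. v m j) + lam * (\<Sum>j<J. flux J (v m) (Suc j) - flux J (v m) j)
          + d * (\<Sum>j<J. b_dx L J f \<beta> \<gamma> j)"
        by (simp only: sum.distrib sum_distrib_left)
      finally show ?case using Suc by (simp add: avg_def sum_flux_diff sum_b_dx[OF L_pos J mass])
    qed simp
    from this[of n] have "(\<Sum>j<J. v n j) = (\<Sum>j<J. v 0 j)" using J0 by (simp add: avg_def)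
    then have "avg J (Er n) - avg J (Er 0) = avg J (\<lambda>j. u (T n) (grid L J j) - u 0 (grid L J j))"
      by (simp add: avg_def Er_def W_def X_def T_def sum_subtractf diff_divide_distrib)
    moreover have "\<bar>avg J (\<lambda>j. u (T n) (grid L J j) - u 0 (grid L J j))\<bar> \<le> 2 * (2 * N * L) * dx L J"
    proof (rule avg_grid_le_of_integral_zero[OF L_pos J space_lipschitz_minus_initial[OF Tn]])
      have "continuous_on {0..L} (u (T n))" "continuous_on {0..L} (u 0)"
        using DERIV_continuous_on[OF ux[OF Tn]] DERIV_continuous_on[OF U1] by auto
      then have "u (T n) integrable_on {0..L}" "u 0 integrable_on {0..L}"
        by (auto intro: integrable_continuous_real)
      moreover have "continuous_on {0..L} f"
        by (rule lipschitz_on_continuous_on[of R1])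
          (use R1 nonneg in \<open>auto simp: lipschitz_on_def dist_real_def\<close>)
      then have "integral {0..L} (u (T n)) = integral {0..L} (u 0)"
        by (intro mass_conservation[OF mass] integrable_continuous_real T)
      ultimately show "integral {0..L} (\<lambda>x. u (T n) x - u 0 x) = 0"
        by (simp add: integral_diff)
    qed
    ultimately show ?thesis by (simp add: h_def)
  qed
  have "l2norm J (Er n) \<le> l2norm J (Er 0) + 4 * N * L * h + (h * ((N + R) * L) + 16 * L\<^sup>2 * r)"
  proof (rule l2norm_le_of_parts[OF J0 mean])
    show "l2norm J (\<lambda>j. Er n j - avg J (Er n))
        \<le> l2norm J (\<lambda>j. Er 0 j - avg J (Er 0)) + (h * ((N + R) * L) + 16 * L\<^sup>2 * r)"
      using split(2)[of n] split(1)[of 0] stab by linarith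
    have "0 \<le> r" using \<rho>_bound[OF J0, of 0] by linarith
    then show "0 \<le> h * ((N + R) * L) + 16 * L\<^sup>2 * r" using nonneg h L_pos by simp
  qed
  then show ?thesis
    by (simp add: Er_def W_def T_def X_def r_def E_def h_def add.assoc)
qed

end

theorem theorem4p1:
  fixes L :: real
  assumes "L > 0"
  shows "\<exists>C>0. \<forall>(f :: real \<Rightarrow> real) (F :: nat \<Rightarrow> real \<Rightarrow> real) (\<beta> :: real) (\<gamma> :: real)
            (u0 :: real \<Rightarrow> real) (U :: nat \<Rightarrow> real \<Rightarrow> real) (u :: real \<Rightarrow> real \<Rightarrow> real)
            (J :: nat) (\<delta>t :: real) (v :: nat \<Rightarrow> nat \<Rightarrow> real).
     Ck_derivs L 3 f F \<longrightarrow>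
     \<gamma> - \<beta> + integral {0..L} f = 0 \<longrightarrow>
     Hk_derivs L 6 u0 U \<longrightarrow>
     U 1 0 = \<beta> \<longrightarrow> U 1 L = \<gamma> \<longrightarrow>
     U 3 0 = - F 1 0 \<longrightarrow> U 3 L = - F 1 L \<longrightarrow>
     U 5 0 = - F 3 0 \<longrightarrow> U 5 L = - F 3 L \<longrightarrow>
     heat_neumann_solution L f \<beta> \<gamma> u0 u \<longrightarrow>
     J \<ge> 2 \<longrightarrow> 0 < \<delta>t \<longrightarrow> \<delta>t < 1 \<longrightarrow> \<delta>t / (dx L J)^2 \<le> 1 / 2 \<longrightarrow>
     (\<forall>n. \<forall>j<J. v (Suc n) j = v n j + \<delta>t * (\<Sum>k<J. Pmat J (dx L J) j k * v n k)
                                 + \<delta>t * b_dx L J f \<beta> \<gamma> j) \<longrightarrow>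
     (\<forall>n::nat. l2norm J (\<lambda>j. proj L J (u (real n * \<delta>t)) j - v n j)
        \<le> l2norm J (\<lambda>j. proj L J u0 j - v 0 j)
          + C * (dx L J + \<delta>t) * (H_norm L 5 u0 + H_norm L 3 f))"
proof -
  \<comment> \<open>\<open>A\<close> and \<open>B\<close> collect the coefficients of the mesh size
    and of the time step in \<open>scheme_error\<close> once \<open>M\<close>, \<open>N\<close>,
    \<open>R\<close> and \<open>R1\<close> all equal \<open>S\<close>; \<open>K\<close> is the
    embedding constant.\<close>
  define A where "A = 4 * L + 2 * L + 16 * L\<^sup>2 * (2 * (4 * L + 1) + 2 / L + 2 * L)"
  define B where "B = 16 * L\<^sup>2 * (3 / 2)"
  define K where "K = (1 + L)\<^sup>2 / L"
  have pos: "A > 0" "B > 0" "K > 0"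
    using \<open>L > 0\<close> by (auto simp: A_def B_def K_def intro!: add_pos_pos mult_pos_pos divide_pos_pos)
  show ?thesis
  proof (intro exI[of _ "(A + B) * K"] conjI allI impI)
    show "(A + B) * K > 0" using pos by simp
    fix f F \<beta> \<gamma> u0 U u J \<delta>t v n
    assume F: "Ck_derivs L 3 f F" and mass: "\<gamma> - \<beta> + integral {0..L} f = 0"
      and U: "Hk_derivs L 6 u0 U" and U1_bc: "U 1 0 = \<beta>" "U 1 L = \<gamma>"
      and U3_bc: "U 3 0 = - F 1 0" "U 3 L = - F 1 L"
      and sol: "heat_neumann_solution L f \<beta> \<gamma> u0 u"
      and J: "J \<ge> 2" and \<delta>t: "0 < \<delta>t" "\<delta>t / (dx L J)\<^sup>2 \<le> 1 / 2"
      and scheme: "\<forall>n. \<forall>j<J. v (Suc n) j = v n j + \<delta>t * (\<Sum>k<J. Pmat J (dx L J) j k * v n k)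
                                 + \<delta>t * b_dx L J f \<beta> \<gamma> j"
    obtain ux uxx ut where sol':
      "continuous_on ({0..} \<times> {0..L}) (\<lambda>(t, x). u t x)"
      "continuous_on ({0<..} \<times> {0..L}) (\<lambda>(t, x). uxx t x)"
      "continuous_on ({0<..} \<times> {0..L}) (\<lambda>(t, x). ut t x)"
      "\<And>t x. t > 0 \<Longrightarrow> x \<in> {0..L} \<Longrightarrow> (u t has_real_derivative ux t x) (at x within {0..L})"
      "\<And>t x. t > 0 \<Longrightarrow> x \<in> {0..L} \<Longrightarrow> (ux t has_real_derivative uxx t x) (at x within {0..L})"
      "\<And>t x. t > 0 \<Longrightarrow> x \<in> {0..L} \<Longrightarrow> ((\<lambda>s. u s x) has_real_derivative ut t x) (at t)"
      "\<And>t x. t > 0 \<Longrightarrow> x \<in> {0<..<L} \<Longrightarrow> ut t x - uxx t x = f x"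
      "\<And>t. t > 0 \<Longrightarrow> ux t 0 = \<beta>" "\<And>t. t > 0 \<Longrightarrow> ux t L = \<gamma>"
      "\<And>x. x \<in> {0..L} \<Longrightarrow> u 0 x = u0 x"
      using sol unfolding heat_neumann_solution_def by (elim exE conjE) blast
    define S where "S = K * (H_norm L 5 u0 + H_norm L 3 f)"
    \<comment> \<open>The chain of order 6 is cut to order 5 to be measured in that norm; this still
      controls orders up to 4 in the supremum.\<close>
    have U_bound: "\<bar>U i x\<bar> \<le> K * H_norm L 5 u0" if "i < 5" "x \<in> {0..L}" for i x
      unfolding K_def using that \<open>L > 0\<close> by (intro sup_le_H_norm Hk_derivs_mono[OF U]) auto
    have F_bound: "\<bar>F i x\<bar> \<le> K * H_norm L 3 f" if "i < 3" "x \<in> {0..L}" for i x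
      unfolding K_def using that \<open>L > 0\<close> F by (intro sup_le_H_norm Ck_derivs_imp_Hk_derivs)
    have S0: "0 \<le> K * H_norm L 5 u0" "0 \<le> K * H_norm L 3 f"
      using U_bound[of 0 0] F_bound[of 0 0] \<open>L > 0\<close> by (auto intro: order_trans[OF abs_ge_zero])
    have UF: "\<bar>U i x + F j x\<bar> \<le> S" "\<bar>F j x\<bar> \<le> S" if "i < 5" "j < 3" "x \<in> {0..L}" for i j x
      using U_bound[OF that(1,3)] F_bound[OF that(2,3)] S0 by (auto simp: S_def distrib_left)
    have F0: "F 0 x = f x" if "x \<in> {0..L}" for x using F that by (simp add: Ck_derivs_def)
    have dF: "(F i has_real_derivative F (Suc i) x) (at x within {0..L})" if "i < 3" "x \<in> {0..L}" for i x
      using F that by (auto simp: Ck_derivs_def)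
    have dU: "(U i has_real_derivative U (Suc i) x) (at x within {0..L})" if "i < 5" "x \<in> {0..L}" for i x
      using Hk_derivs_DERIV[OF U, of i x] that by simp
    have df: "(f has_real_derivative F 1 x) (at x within {0..L})" if "x \<in> {0..L}" for x
    proof -
      have "(F 0 has_real_derivative F 1 x) (at x within {0..L})" using dF[of 0 x] that by simp
      then show ?thesis
        by (rule has_field_derivative_transform_within[OF _ zero_less_one that]) (use F0 in auto)
    qed
    have f_cont: "continuous_on {0..L} f" using DERIV_continuous_on[OF df] by auto
    \<comment> \<open>The conditions on the third derivative of the initial value are exactly
      \<open>G1_bc\<close>.\<close>
    interpret neumann_heat_regular L \<beta> \<gamma> f u ux uxx ut "U 1" "U 2" "\<lambda>x. U 3 x + F 1 x"
      "\<lambda>x. U 4 x + F 2 x" S S S S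
    proof
      fix t x :: real assume t: "t > 0" and x: "x \<in> {0..L}"
      have pair: "continuous_on {0..L} (\<lambda>x. (t, x))" "(\<lambda>x. (t, x)) ` {0..L} \<subseteq> {0<..} \<times> {0..L}"
        using t by (auto intro!: continuous_intros)
      have slice: "continuous_on {0..L} (ut t)" "continuous_on {0..L} (uxx t)"
        using continuous_on_compose2[OF sol'(3) pair] continuous_on_compose2[OF sol'(2) pair] by simp_all
      \<comment> \<open>The equation passes to the end points by continuity in space at a fixed
        positive time.\<close>
      have "ut t x - uxx t x - f x = 0"
      proof (rule continuous_constant_on_closure[of "{0<..<L}" "\<lambda>x. ut t x - uxx t x - f x"])
        show "continuous_on (closure {0<..<L}) (\<lambda>x. ut t x - uxx t x - f x)"
          using slice f_cont \<open>L > 0\<close> by (auto intro!: continuous_intros)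
      qed (use sol'(7)[OF t] x \<open>L > 0\<close> in auto)
      then show "ut t x = uxx t x + f x" by simp
    next
      fix x assume x: "x \<in> {0..L}"
      show "(u 0 has_real_derivative U 1 x) (at x within {0..L})"
      proof -
        have "(U 0 has_real_derivative U 1 x) (at x within {0..L})" using dU[of 0 x] x by simp
        then show ?thesis
          by (rule has_field_derivative_transform_within[OF _ zero_less_one x])
            (use sol'(10) Hk_derivs_0[OF U] in auto)
      qed
      show "(U 1 has_real_derivative U 2 x) (at x within {0..L})"
        using dU[of 1 x] x by (simp add: numeral_2_eq_2)
      show "((\<lambda>x. U 2 x + f x) has_real_derivative U 3 x + F 1 x) (at x within {0..L})"
        using DERIV_add[OF dU[of 2 x] df[OF x]] x by (simp add: numeral_2_eq_2 numeral_3_eq_3)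
      show "((\<lambda>x. U 3 x + F 1 x) has_real_derivative U 4 x + F 2 x) (at x within {0..L})"
        using DERIV_add[OF dU[of 3 x] dF[of 1 x]] x by (simp add: numeral_2_eq_2)
      show "\<bar>U 4 x + F 2 x\<bar> \<le> S" using UF x by simp
      show "\<bar>U 2 x + f x\<bar> \<le> S" "\<bar>f x\<bar> \<le> S" using UF[of 2 0 x] x F0 by auto
    next
      fix x y assume "x \<in> {0..L}" "y \<in> {0..L}"
      then have "norm (f x - f y) \<le> S * norm (x - y)"
        by (intro field_differentiable_bound[where S = "{0..L}", OF _ df]) (use UF(2)[of 0 1] in auto)
      then show "\<bar>f x - f y\<bar> \<le> S * \<bar>x - y\<bar>" by simp
    qed (use sol' \<open>L > 0\<close> U1_bc U3_bc in auto)
    define h where "h = dx L J"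
    have h: "h > 0" using dx_bounds[OF \<open>L > 0\<close> J] by (simp add: h_def)
    have "l2norm J (\<lambda>j. u (real n * \<delta>t) (grid L J j) - v n j)
        \<le> l2norm J (\<lambda>j. u 0 (grid L J j) - v 0 j)
      + 4 * S * L * h + h * ((S + S) * L)
      + 16 * L\<^sup>2 * (3 / 2 * S * \<delta>t + 2 * (4 * S * L + S) * h + (S + S) * h / L + 2 * S * L * h)"
      unfolding h_def by (rule scheme_error[OF mass J \<delta>t]) (use scheme in auto)
    also have "l2norm J (\<lambda>j. u 0 (grid L J j) - v 0 j) = l2norm J (\<lambda>j. proj L J u0 j - v 0 j)"
      by (intro l2norm_cong) (use sol'(10) grid_mem[OF \<open>L > 0\<close> _ J] in \<open>simp add: proj_def\<close>)
    also have "l2norm J (\<lambda>j. proj L J u0 j - v 0 j) + 4 * S * L * h + h * ((S + S) * L)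
      + 16 * L\<^sup>2 * (3 / 2 * S * \<delta>t + 2 * (4 * S * L + S) * h + (S + S) * h / L + 2 * S * L * h)
      = l2norm J (\<lambda>j. proj L J u0 j - v 0 j) + (A * h + B * \<delta>t) * S"
      using \<open>L > 0\<close> by (simp add: A_def B_def field_simps)
    also have "(A * h + B * \<delta>t) * S \<le> (A + B) * (h + \<delta>t) * S"
    proof (rule mult_right_mono)
      show "A * h + B * \<delta>t \<le> (A + B) * (h + \<delta>t)" using pos h \<delta>t by (simp add: algebra_simps)
      show "0 \<le> S" using S0 by (simp add: S_def distrib_left)
    qed
    finally show "l2norm J (\<lambda>j. proj L J (u (real n * \<delta>t)) j - v n j)
        \<le> l2norm J (\<lambda>j. proj L J u0 j - v 0 j)
          + (A + B) * K * (dx L J + \<delta>t) * (H_norm L 5 u0 + H_norm L 3 f)"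
      by (simp add: S_def h_def proj_def ac_simps)
  qed
qed

end
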